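(* Let $(M,\mathbf T)$ be a triangulated closed orientable pseudo 3-manifold, equipped with an orientation, and let $p\in SAS(\mathbf T)$ be a maximum point of the volume function $\mathbf V: SAS(\mathbf T)\to\mathbb R$. (a) If $p$ is a smooth point for $\mathbf V$, then the generalized Thurston gluing equation associated to $(M,\mathbf T)$ has a solution. (b) If $p$ is a non-smooth point for $\mathbf V$, then Haken's normal surface equation associated to $(M,\mathbf T)$ has a solution with exactly one or two non-zero quadrilateral coordinates.
   Context: Triangulations. Let $X$ be a disjoint union of finitely many oriented Euclidean tetrahedra, and identify the codimension-1 faces of $X$ in pairs by orientation-reversing affine homeomorphisms. The quotient $M$ is an oriented closed pseudo 3-manifold, and the images of the simplices of $X$ form its triangulation $\mathbf T$ (simplices need not be embedded in $M$). $V,E,F,T$ are the sets of vertices, edges, triangles and tetrahedra of $\mathbf T$. An edge $e\in E$ is regarded as an equivalence class of edges $e^*$ of the tetrahedra of $X$ (those identified to $e$). Normal disks. In a tetrahedron there are, up to normal isotopy, four normal triangles (one cutting off each vertex) and three normal quadrilaterals (one for each pair of opposite edges: the quadrilateral is disjoint from exactly these two edges). $\triangle$ and $\Box$ denote the sets of all normal isotopy classes of normal triangles and quadrilaterals in the tetrahedra of $\mathbf T$; $q\subset\sigma$ means that $q$ lies in the tetrahedron $\sigma$. For $q\in\Box$, $e\in E$, the index $i(q,e)\in\{0,1,2\}$ is the number of edges $e^*$ in the class $e$ that lie in the same tetrahedron (of $X$) as $q$ and are disjoint from $q$. Haken's normal surface equation. It is the linear system for $x\in\mathbb R^{\triangle}\times\mathbb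 R^{\Box}$ with one equation for each normal isotopy class of normal arcs $a$ in the triangles of $\mathbf T$ (an arc in a triangle joining two different edges). If $\sigma,\sigma'$ are the tetrahedra on the two sides of the triangle containing $a$, the equation is $x(t)+x(q)=x(t')+x(q')$, where $t,q\subset\sigma$ and $t',q'\subset\sigma'$ are the normal triangles and quadrilaterals having $a$ as an edge on the respective sides. (If $a$ cuts off vertex $v$ in a face of $\sigma$ with vertices $v,u,w$ and $y$ is the fourth vertex of $\sigma$, then $t$ is the triangle cutting off $v$ and $q$ is the quadrilateral separating $\{v,y\}$ from $\{u,w\}$.) The numbers $x(q)$, $q\in\Box$, are the quadrilateral coordinates of $x$. Orientation convention. For an oriented tetrahedron $\sigma$ with vertices $v_0,v_1,v_2,v_3$ ordered compatibly with the orientation, let $q_1,q_2,q_3$ be the quadrilaterals disjoint from the edges $\{v_0v_1,v_2v_3\}$, $\{v_0v_2,v_1v_3\}$, $\{v_0v_3,v_1v_2\}$. The cyclic order $q_1\to q_2\to q_3\to q_1$ depends only on the orientation. For $q,q'\in\Box$ we set $\omega(q,q')=1$ if $q,q'$ lie in the same tetrahedron and $q\to q'$ in this cyclic order. Generalized Thurston gluing equation. A solution is $z:\Box\to\mathbb C\setminus\{0,1\}$ ($z(q)$ being the number assigned to the two opposite edges disjoint from $q$) such that $z(q')=\frac{1}{1-z(q)}$ whenever $\omega(q,q')=1$ (so the three values in a tetrahedron are $z,\frac1{1-z},\frac{z-1}{z}$), and for each edge $e\in E$, $\prod_{q\in\Box}z(q)^{i(q,e)}=\pm1$ (the sign may depend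 on $e$). Angle structures and volume. Let $\mathbf S^1$ be the unit circle in $\mathbb C$. $SAS(\mathbf T)$ (also written $SAS(M,\mathbf T)$) is the set of all $x:\Box\to\mathbf S^1$ such that $\prod_{q\subset\sigma}x(q)=-1$ for each $\sigma\in T$ and $\prod_{q\in\Box}x(q)^{i(q,e)}=1$ for each $e\in E$. Let $\Lambda(x)=-\int_0^x\ln|2\sin u|\,du$ be the Lobachevsky function (continuous, of period $\pi$). The volume is $\mathbf V(x)=\sum_{q\in\Box}\Lambda(\arg x(q))$. A point $x$ is a smooth point for $\mathbf V$ if $x(q)\ne\pm1$ for all $q\in\Box$, and a non-smooth point otherwise. *)

theory Defs
  imports "HOL-Analysis.Analysis" "HOL-Combinatorics.Permutations"
begin

text \<open>
  Every tetrahedron of X has its vertices labelled by 0, 1, 2, 3 in an order compatible with its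
  orientation.  Face \<open>k\<close> of a tetrahedron is the one opposite to vertex \<open>k\<close>.  An affine
  homeomorphism from face \<open>k\<close> of \<open>\<sigma>\<close> to a face of \<open>nbr M \<sigma> k\<close> is determined by the induced
  bijection of the vertices; \<open>perm M \<sigma> k\<close> is the extension of this bijection to all four labels,
  so that the target is face \<open>perm M \<sigma> k k\<close>.
\<close>

record 'a gluing =
  tets :: "'a set"
  nbr :: "'a \<Rightarrow> nat \<Rightarrow> 'a"
  perm :: "'a \<Rightarrow> nat \<Rightarrow> nat \<Rightarrow> nat"

abbreviation vlabels :: "nat set" where
  "vlabels \<equiv> {0, 1, 2, 3}"

text \<open>
  The boundary orientation of face \<open>k\<close> is \<open>(-1)^k\<close> times the one given by increasing labels, hence
  a face map is orientation-reversing iff its extension is an odd permutation.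
\<close>

definition oriented_triangulation :: "'a gluing \<Rightarrow> bool" where
  "oriented_triangulation M \<longleftrightarrow>
     finite (tets M) \<and>
     (\<forall>\<sigma>\<in>tets M. \<forall>k\<in>vlabels.
        nbr M \<sigma> k \<in> tets M \<and>
        perm M \<sigma> k permutes vlabels \<and>
        sign (perm M \<sigma> k) = -1 \<and>
        (nbr M \<sigma> k, perm M \<sigma> k k) \<noteq> (\<sigma>, k) \<and>
        nbr M (nbr M \<sigma> k) (perm M \<sigma> k k) = \<sigma> \<and>
        perm M (nbr M \<sigma> k) (perm M \<sigma> k k) = inv (perm M \<sigma> k))"

type_synonym 'a tet_edge = "'a \<times> nat set"

definition tet_edges :: "'a gluing \<Rightarrow> 'a tet_edge set" where
  "tet_edges M = {(\<sigma>, s). \<sigma> \<in> tets M \<and> s \<subseteq> vlabels \<and> card s = 2}"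

definition edge_glue :: "'a gluing \<Rightarrow> ('a tet_edge \<times> 'a tet_edge) set" where
  "edge_glue M = {((\<sigma>, s), (nbr M \<sigma> k, perm M \<sigma> k ` s)) | \<sigma> s k.
     (\<sigma>, s) \<in> tet_edges M \<and> k \<in> vlabels \<and> k \<notin> s}"

definition edges :: "'a gluing \<Rightarrow> 'a tet_edge set set" where
  "edges M = tet_edges M // (edge_glue M \<union> (edge_glue M)\<inverse>)\<^sup>*"

text \<open>
  A normal triangle is a pair of a tetrahedron and the vertex cut off.  A normal quadrilateral is a
  pair of a tetrahedron and the pair of opposite edges from which it is disjoint; equivalently, these
  two edges are the two sets of vertices that it separates from each other.
\<close>

type_synonym 'a ntri = "'a \<times> nat"
type_synonym 'a nquad = "'a \<times> nat set set"

definition opp_pair :: "nat set \<Rightarrow> nat set set" where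
  "opp_pair s = {s, vlabels - s}"

definition quads_in :: "'a \<Rightarrow> 'a nquad set" where
  "quads_in \<sigma> = {(\<sigma>, opp_pair s) | s. s \<subseteq> vlabels \<and> card s = 2}"

definition quads :: "'a gluing \<Rightarrow> 'a nquad set" where
  "quads M = (\<Union>\<sigma>\<in>tets M. quads_in \<sigma>)"

definition quad_index :: "'a nquad \<Rightarrow> 'a tet_edge set \<Rightarrow> nat" where
  "quad_index q e = card {d \<in> e. fst d = fst q \<and> snd d \<in> snd q}"

definition quad_next :: "'a nquad \<Rightarrow> 'a nquad \<Rightarrow> bool" where
  "quad_next q q' \<longleftrightarrow> fst q = fst q' \<and>
     (snd q, snd q') \<in> {(opp_pair {0, 1}, opp_pair {0, 2}),
                        (opp_pair {0, 2}, opp_pair {0, 3}),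
                        (opp_pair {0, 3}, opp_pair {0, 1})}"

text \<open>
  A normal arc in face \<open>k\<close> of \<open>\<sigma>\<close> is given by the vertex \<open>v \<noteq> k\<close> it cuts off.  Every arc is listed
  from both sides of its face, which yields the same equation twice.
\<close>

definition haken_solution :: "'a gluing \<Rightarrow> ('a ntri \<Rightarrow> real) \<Rightarrow> ('a nquad \<Rightarrow> real) \<Rightarrow> bool" where
  "haken_solution M xt xq \<longleftrightarrow>
     (\<forall>\<sigma>\<in>tets M. \<forall>k\<in>vlabels. \<forall>v\<in>vlabels - {k}.
        let \<sigma>' = nbr M \<sigma> k; k' = perm M \<sigma> k k; v' = perm M \<sigma> k v in
        xt (\<sigma>, v) + xq (\<sigma>, opp_pair {v, k}) = xt (\<sigma>', v') + xq (\<sigma>', opp_pair {v', k'}))"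

definition thurston_solution :: "'a gluing \<Rightarrow> ('a nquad \<Rightarrow> complex) \<Rightarrow> bool" where
  "thurston_solution M z \<longleftrightarrow>
     z \<in> quads M \<rightarrow> - {0, 1} \<and>
     (\<forall>q\<in>quads M. \<forall>q'\<in>quads M. quad_next q q' \<longrightarrow> z q' = 1 / (1 - z q)) \<and>
     (\<forall>e\<in>edges M. (\<Prod>q\<in>quads M. z q ^ quad_index q e) \<in> {1, -1})"

definition SAS :: "'a gluing \<Rightarrow> ('a nquad \<Rightarrow> complex) set" where
  "SAS M = {x \<in> quads M \<rightarrow>\<^sub>E sphere 0 1.
     (\<forall>\<sigma>\<in>tets M. (\<Prod>q\<in>quads_in \<sigma>. x q) = -1) \<and>
     (\<forall>e\<in>edges M. (\<Prod>q\<in>quads M. x q ^ quad_index q e) = 1)}"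

text \<open>The interval integral is oriented, so that this is the intended value also for negative \<open>x\<close>.\<close>

definition Lobachevsky :: "real \<Rightarrow> real" where
  "Lobachevsky x = - (LBINT u=0..x. ln \<bar>2 * sin u\<bar>)"

definition SAS_volume :: "'a gluing \<Rightarrow> ('a nquad \<Rightarrow> complex) \<Rightarrow> real" where
  "SAS_volume M x = (\<Sum>q\<in>quads M. Lobachevsky (Arg (x q)))"

definition smooth_point :: "'a gluing \<Rightarrow> ('a nquad \<Rightarrow> complex) \<Rightarrow> bool" where
  "smooth_point M x \<longleftrightarrow> (\<forall>q\<in>quads M. x q \<noteq> 1 \<and> x q \<noteq> -1)"

end

theory Submission
  imports Defs "HOL-Real_Asymp.Real_Asymp"
begin

text \<open>
  Rotating the values of \<open>p\<close> by \<open>cis (t * y q)\<close> stays inside the space of angle structures for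
  every \<open>y\<close> in the linear space of solutions of the homogeneous tetrahedron and edge equations
  (\<open>SAS_flow\<close>).  Along such a line the volume is differentiable in the coordinates with
  \<open>p q \<noteq> 1, -1\<close>, where the derivative of the Lobachevsky function is \<open>- ln \<bar>2 * Im (p q)\<bar>\<close>.  In a
  coordinate of the set \<open>U\<close> of quadrilaterals with \<open>p q = 1\<close> or \<open>p q = -1\<close> it contributes
  \<open>- (t * y q) * ln \<bar>t * y q\<bar>\<close> up to a term differentiable at \<open>t = 0\<close>.  Maximality kills the
  dominating term \<open>(\<Sum>q\<in>U. y q) * (t * ln \<bar>t\<bar>)\<close>, so that the remaining function is differentiable
  at its maximum \<open>t = 0\<close>; this gives an identity between a linear function of \<open>y\<close> and
  \<open>\<Sum>q\<in>U. y q * ln \<bar>y q\<bar>\<close> on the whole tangent space (\<open>volume_maximum_critical\<close>).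

  If \<open>U\<close> is empty, the vector \<open>- ln \<bar>2 * Im (p q)\<bar>\<close> annihilates the tangent space and therefore is
  a combination of the tetrahedron and the edge equations (\<open>tangent_SAS_annihilator\<close>).  In each
  tetrahedron the values \<open>x, x', x''\<close> of \<open>p\<close> are the angles of a triangle, whose shape is
  \<open>z = x * (Im x' / Im x'')\<close> by the law of sines.  The arguments satisfy the edge equations because
  \<open>p\<close> does, up to signs.  The moduli do because the antisymmetric pairing
  \<open>\<Sum>q. i(q,e) * (i(q'',f) - i(q',f))\<close> of two edges vanishes: it is a sum over the corners of the
  faces of the tetrahedra, and the two sides of a face cancel, since the face pairings reverse the
  orientation (\<open>sum_flags_eq_0\<close>).

  If \<open>U\<close> is nonempty, the function \<open>\<Sum>q\<in>U. y q * ln \<bar>y q\<bar>\<close> is linear on the tangent space.  At a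
  point where just one of the coordinates in \<open>U\<close> vanishes it would not be differentiable, so that
  on the tangent space either some coordinate in \<open>U\<close> vanishes identically or two of them are
  proportional (\<open>entropy_linear_imp_dependent\<close>).  This is a vector with one or two nonzero entries
  that annihilates the tangent space, and every annihilator of the tangent space is the vector of
  quadrilateral coordinates of a solution of the normal surface equation
  (\<open>haken_solution_from_edges\<close>).
\<close>

section \<open>Integrability of the logarithm of the sine\<close>

lemma sin_ge_third:
  fixes x :: real
  assumes "0 \<le> x" "x \<le> pi / 2"
  shows "x / 3 \<le> sin x"
proof -
  have "\<bar>sin x - (\<Sum>m<3. sin_coeff m * x ^ m)\<bar> \<le> inverse (fact 3) * \<bar>x\<bar> ^ 3"
    by (rule Maclaurin_sin_bound)
  hence "\<bar>sin x - x\<bar> \<le> x ^ 3 / 6"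
    using assms by (simp add: sin_coeff_def fact_numeral numeral_3_eq_3 lessThan_Suc field_simps)
  moreover have "x * x \<le> 2 * 2"
    by (rule mult_mono) (use assms pi_less_4 in auto)
  hence "x * (x * x) \<le> x * 4"
    using assms by (intro mult_left_mono) auto
  ultimately show ?thesis unfolding power3_eq_cube mult.assoc by linarith
qed

text \<open>
  The three zeros of the sine in \<open>[-pi, pi]\<close> are simple.  Taking logarithms, this bounds
  \<open>ln \<bar>sin u\<bar>\<close> from below by integrable functions.
\<close>

lemma abs_sin_ge_product:
  fixes u :: real
  assumes "\<bar>u\<bar> \<le> pi"
  shows "\<bar>u\<bar> * \<bar>u - pi\<bar> * \<bar>u + pi\<bar> / 144 \<le> \<bar>sin u\<bar>"
proof -
  define v where "v = \<bar>u\<bar>"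
  have v: "0 \<le> v" "v \<le> pi" using assms by (auto simp: v_def)
  \<comment> \<open>Both half angles lie in \<open>[0, pi/2]\<close>, and their sines multiply to \<open>sin v / 2\<close>.\<close>
  have "(v / 6) * ((pi - v) / 6) \<le> sin (v / 2) * sin ((pi - v) / 2)"
    using sin_ge_third[of "v / 2"] sin_ge_third[of "(pi - v) / 2"] v
    by (intro mult_mono sin_ge_zero) auto
  moreover have "sin v = 2 * (sin (v / 2) * sin ((pi - v) / 2))"
    using sin_double[of "v / 2"] cos_sin_eq[of "v / 2"] by (simp add: diff_divide_distrib)
  ultimately have "v * (pi - v) / 18 \<le> sin v" by simp
  moreover have "v * (pi - v) * (v + pi) \<le> v * (pi - v) * 8"
    using v pi_less_4 by (intro mult_left_mono) auto
  moreover have "\<bar>u\<bar> * \<bar>u - pi\<bar> * \<bar>u + pi\<bar> = v * (pi - v) * (v + pi)"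
    using assms by (auto simp: v_def abs_if)
  moreover have "\<bar>sin u\<bar> = \<bar>sin v\<bar>" by (simp add: v_def abs_if)
  ultimately show ?thesis by linarith
qed

lemma DERIV_ln_abs:
  fixes u :: real
  assumes "u \<noteq> 0"
  shows "((\<lambda>u. ln \<bar>u\<bar>) has_real_derivative 1 / u) (at u)"
proof (cases "u > 0")
  case True
  show ?thesis
    by (rule has_field_derivative_transform_within_open[where f = ln and S = "{0<..}"])
      (use True in \<open>auto intro!: derivative_eq_intros\<close>)
next
  case False
  show ?thesis
    by (rule has_field_derivative_transform_within_open[where f = "\<lambda>u. ln (- u)" and S = "{..<0}"])
      (use False assms in \<open>auto intro!: derivative_eq_intros\<close>)
qed

lemma absolutely_integrable_ln_abs:
  fixes a b c :: real
  shows "(\<lambda>u. ln \<bar>u - c\<bar>) absolutely_integrable_on {a..b}"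
proof (cases "a \<le> b")
  case True
  \<comment> \<open>\<open>G\<close> is a primitive of \<open>ln \<bar>u\<bar>\<close> that extends continuously through the singularity.\<close>
  define G where "G = (\<lambda>u::real. u * ln \<bar>u\<bar> - u)"
  have G0: "isCont G 0"
    unfolding G_def isCont_def tendsto_at_iff_tendsto_nhds by simp real_asymp
  have GD: "(G has_real_derivative ln \<bar>u\<bar>) (at u)" if "u \<noteq> 0" for u
    using DERIV_diff[OF DERIV_mult[OF DERIV_ident DERIV_ln_abs[OF that]] DERIV_ident] that
    unfolding G_def by simp
  have Gc: "continuous_on UNIV G"
    using G0 GD by (metis DERIV_isCont continuous_at_imp_continuous_on)
  have "((\<lambda>u. ln \<bar>u - c\<bar>) has_integral (G (b - c) - G (a - c))) {a..b}"
  proof (rule fundamental_theorem_of_calculus_interior_strong[of "{c}" _ _ "\<lambda>u. G (u - c)"])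
    show "continuous_on {a..b} (\<lambda>u. G (u - c))"
      by (rule continuous_on_compose2[OF Gc]) (auto intro!: continuous_intros)
    fix x assume "x \<in> {a<..<b} - {c}"
    hence "(G has_real_derivative ln \<bar>x - c\<bar>) (at (x - c))" by (intro GD) auto
    hence "((\<lambda>u. G (u - c)) has_real_derivative ln \<bar>x - c\<bar>) (at x)"
      using DERIV_shift[of G _ x "- c"] by simp
    thus "((\<lambda>u. G (u - c)) has_vector_derivative ln \<bar>x - c\<bar>) (at x)"
      by (simp add: has_real_derivative_iff_has_vector_derivative)
  qed (use True in auto)
  hence int: "(\<lambda>u. ln \<bar>u - c\<bar>) integrable_on {a..b}" by blast
  \<comment> \<open>The integrand is bounded above by \<open>K\<close>, so that integrability implies absolute integrability.\<close>
  define K where "K = \<bar>a\<bar> + \<bar>b\<bar> + \<bar>c\<bar>"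
  have "(\<lambda>u. K - ln \<bar>u - c\<bar>) absolutely_integrable_on {a..b}"
  proof (rule nonnegative_absolutely_integrable_1)
    show "(\<lambda>u. K - ln \<bar>u - c\<bar>) integrable_on {a..b}"
      using int by (intro integrable_diff) auto
    fix x assume "x \<in> {a..b}"
    moreover have "ln \<bar>x - c\<bar> \<le> \<bar>x - c\<bar>"
      using ln_bound[of "\<bar>x - c\<bar>"] by (cases "x = c") auto
    ultimately show "0 \<le> K - ln \<bar>x - c\<bar>" by (auto simp: K_def)
  qed
  from set_integral_diff(1)[OF absolutely_integrable_on_const this, of K]
  show ?thesis by simp
qed (auto simp: set_integrable_def)

text \<open>
  The integrand of the Lobachevsky function.  At the multiples of \<open>pi\<close> it has the value \<open>ln 0 = 0\<close>.
\<close>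

definition log_sin :: "real \<Rightarrow> real" where
  "log_sin u = ln \<bar>2 * sin u\<bar>"

lemma log_sin_integrable: "set_integrable lborel {-pi..pi} log_sin"
proof -
  have meas: "log_sin \<in> borel_measurable borel"
    unfolding log_sin_def by measurable
  define B where "B = (\<lambda>u::real. 72 + \<bar>ln \<bar>u - 0\<bar>\<bar> + \<bar>ln \<bar>u - pi\<bar>\<bar> + \<bar>ln \<bar>u - (- pi)\<bar>\<bar>)"
  have "log_sin absolutely_integrable_on {-pi..pi}"
  proof (rule measurable_bounded_by_integrable_imp_absolutely_integrable)
    show "log_sin \<in> borel_measurable (lebesgue_on {-pi..pi})"
      by (rule measurable_restrict_space1, rule measurable_completion) (use meas in simp)
    have *: "(\<lambda>u. \<bar>ln \<bar>u - c\<bar>\<bar>) absolutely_integrable_on {-pi..pi}" for c :: real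
      using set_integrable_abs[OF absolutely_integrable_ln_abs] .
    hence "B absolutely_integrable_on {-pi..pi}"
      unfolding B_def by (intro set_integral_add(1) absolutely_integrable_on_const *) auto
    thus "B integrable_on {-pi..pi}" by (rule set_lebesgue_integral_eq_integral)
    fix u :: real assume u: "u \<in> {-pi..pi}"
    show "norm (log_sin u) \<le> B u"
    proof (cases "sin u = 0")
      case False
      have abs_u: "\<bar>u\<bar> \<le> pi" using u by auto
      from False have nz: "u \<noteq> 0" "u \<noteq> pi" "u \<noteq> - pi" by auto
      have "ln \<bar>2 * sin u\<bar> \<le> \<bar>2 * sin u\<bar>" using False by (intro ln_bound) auto
      hence up: "log_sin u \<le> 2" using abs_sin_le_one[of u]
        unfolding log_sin_def abs_mult by linarith
      have "ln (\<bar>u\<bar> * \<bar>u - pi\<bar> * \<bar>u + pi\<bar> / 72) \<le> ln \<bar>2 * sin u\<bar>"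
        using abs_sin_ge_product[OF abs_u] nz False by (subst ln_le_cancel_iff) (auto simp: abs_mult)
      moreover have "ln (\<bar>u\<bar> * \<bar>u - pi\<bar> * \<bar>u + pi\<bar> / 72) = ln \<bar>u\<bar> + ln \<bar>u - pi\<bar> + ln \<bar>u + pi\<bar> - ln 72"
        using nz by (simp add: ln_div ln_mult)
      moreover have "ln (72::real) \<le> 72" by (rule ln_bound) simp
      moreover have "\<bar>f\<bar> \<le> 72 + \<bar>a\<bar> + \<bar>b\<bar> + \<bar>c\<bar>"
        if "a + b + c - d \<le> f" "d \<le> 72" "f \<le> 2" for a b c d f :: real
        using that by linarith
      ultimately show ?thesis using up by (simp add: B_def log_sin_def)
    qed (simp add: B_def log_sin_def)
  qed auto
  thus ?thesis using meas unfolding set_integrable_def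
    by (subst (asm) integrable_completion) auto
qed

section \<open>The Lobachevsky function\<close>

lemma isCont_log_sin: "sin u \<noteq> 0 \<Longrightarrow> isCont log_sin u"
  unfolding log_sin_def by (intro continuous_intros) auto

text \<open>
  Only the interval \<open>[-pi, pi]\<close> is needed, because it contains the values of \<open>Arg\<close>.
\<close>

lemma Lobachevsky_eq_integral:
  assumes "x \<in> {-pi..pi}"
  shows "Lobachevsky x = integral {-pi..0} log_sin - integral {-pi..x} log_sin"
proof -
  have eq: "(LBINT u=-pi..y. log_sin u) = integral {-pi..y} log_sin" if "y \<in> {-pi..pi}" for y
    using that by (intro interval_integral_eq_integral set_integrable_subset[OF log_sin_integrable]) auto
  have "(LBINT u=-pi..0. log_sin u) + (LBINT u=0..x. log_sin u) = (LBINT u=-pi..x. log_sin u)"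
  proof (rule interval_integral_sum)
    define m where "m = max 0 x"
    have m: "-pi \<le> m" "m \<le> pi" using assms by (auto simp: m_def)
    have *: "min (ereal (-pi)) (min 0 (ereal x)) = ereal (-pi)"
            "max (ereal (-pi)) (max 0 (ereal x)) = ereal m"
      using assms by (auto simp: m_def min_def max_def zero_ereal_def simp del: ereal_eq_0)
    show "interval_lebesgue_integrable lborel (min (ereal (-pi)) (min 0 (ereal x)))
            (max (ereal (-pi)) (max 0 (ereal x))) log_sin"
      unfolding * using m
      by (auto simp: interval_lebesgue_integrable_def intro!: set_integrable_subset[OF log_sin_integrable])
  qed
  hence "(LBINT u=0..x. log_sin u) = integral {-pi..x} log_sin - integral {-pi..0} log_sin"
    using eq[of 0] eq[OF assms] by (simp add: zero_ereal_def)
  thus ?thesis by (simp add: Lobachevsky_def log_sin_def)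
qed

lemma continuous_on_Lobachevsky: "continuous_on {-pi..pi} Lobachevsky"
proof -
  have "log_sin integrable_on {-pi..pi}"
    using log_sin_integrable set_borel_integral_eq_integral(1) by blast
  hence "continuous_on {-pi..pi} (\<lambda>x. integral {-pi..0} log_sin - integral {-pi..x} log_sin)"
    by (intro continuous_intros indefinite_integral_continuous_1)
  thus ?thesis
    by (rule continuous_on_eq) (simp add: Lobachevsky_eq_integral)
qed

lemma Lobachevsky_0: "Lobachevsky 0 = 0"
  using Lobachevsky_eq_integral[of 0] by simp

lemma DERIV_Lobachevsky:
  assumes "x \<in> {-pi<..<pi}" "x \<noteq> 0"
  shows "(Lobachevsky has_real_derivative - log_sin x) (at x)"
proof -
  have nz: "sin x \<noteq> 0" using assms sin_gt_zero[of x] sin_gt_zero[of "-x"] by (cases "x > 0") auto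
  have "log_sin integrable_on {-pi..pi}"
    using log_sin_integrable set_borel_integral_eq_integral(1) by blast
  hence "((\<lambda>u. integral {-pi..u} log_sin) has_vector_derivative log_sin x) (at x within ({-pi..pi} - {}))"
    using assms continuous_at_imp_continuous_at_within[OF isCont_log_sin[OF nz]]
    by (intro integral_has_vector_derivative_continuous_at) auto
  hence "((\<lambda>u. integral {-pi..u} log_sin) has_real_derivative log_sin x) (at x)"
    using assms at_within_Icc_at[of "-pi" x pi]
    by (simp add: has_real_derivative_iff_has_vector_derivative)
  hence "((\<lambda>u. integral {-pi..0} log_sin - integral {-pi..u} log_sin) has_real_derivative - log_sin x) (at x)"
    by (auto intro!: derivative_eq_intros)
  thus ?thesis
    by (rule has_field_derivative_transform_within_open[where S = "{-pi<..<pi}"])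
      (use assms in \<open>auto simp: Lobachevsky_eq_integral\<close>)
qed

lemma log_sin_double:
  assumes "0 < x" "x < pi / 2"
  shows "log_sin (2 * x) = log_sin x + log_sin (x + pi / 2)"
proof -
  have "sin x > 0" "cos x > 0" using assms by (auto intro!: sin_gt_zero cos_gt_zero)
  moreover have "sin (x + pi / 2) = cos x" by (simp add: sin_add)
  moreover have "ln (4 :: real) = 2 * ln 2" using ln_realpow[of 2 2] by simp
  ultimately show ?thesis by (simp add: log_sin_def sin_double ln_mult)
qed

text \<open>
  By the duplication formula of the sine, the function \<open>D\<close> below is constant; comparing its values
  at the two end points gives \<open>\<Lambda> pi = 2 * \<Lambda> pi\<close>.
\<close>

lemma Lobachevsky_pi: "Lobachevsky pi = 0"
proof -
  define D where "D = (\<lambda>x. Lobachevsky (2 * x) - 2 * Lobachevsky x - 2 * Lobachevsky (x + pi / 2))"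
  have "D (pi / 2) = D 0"
  proof (rule DERIV_isconst_end[where f = D])
    show "continuous_on {0..pi / 2} D"
      unfolding D_def
      by (intro continuous_intros continuous_on_compose2[OF continuous_on_Lobachevsky])
        (auto simp: field_simps)
    fix x assume x: "0 < x" "x < pi / 2"
    have "((\<lambda>x. Lobachevsky (2 * x)) has_real_derivative - log_sin (2 * x) * 2) (at x)"
      by (rule DERIV_chain2[where f = Lobachevsky], rule DERIV_Lobachevsky)
        (use x in \<open>auto intro!: derivative_eq_intros\<close>)
    moreover have "((\<lambda>x. Lobachevsky (x + pi / 2)) has_real_derivative - log_sin (x + pi / 2) * 1) (at x)"
      by (rule DERIV_chain2[where f = Lobachevsky], rule DERIV_Lobachevsky)
        (use x in \<open>auto intro!: derivative_eq_intros\<close>)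
    moreover have "(Lobachevsky has_real_derivative - log_sin x) (at x)"
      by (rule DERIV_Lobachevsky) (use x in auto)
    ultimately show "(D has_real_derivative 0) (at x)"
      unfolding D_def by (auto intro!: derivative_eq_intros simp: log_sin_double[OF x])
  qed simp
  thus ?thesis by (simp add: D_def Lobachevsky_0)
qed

text \<open>
  Hence the jump of \<open>Arg\<close> at \<open>-1\<close> does not affect the volume.
\<close>

lemma Lobachevsky_plus_pi:
  assumes "x \<in> {-pi..0}"
  shows "Lobachevsky (x + pi) = Lobachevsky x"
proof -
  define D where "D = (\<lambda>x. Lobachevsky (x + pi) - Lobachevsky x)"
  have cont: "continuous_on {-pi..0} D"
    unfolding D_def
    by (intro continuous_intros continuous_on_compose2[OF continuous_on_Lobachevsky]) auto
  have der: "(D has_real_derivative 0) (at y)" if y: "-pi < y" "y < 0" for y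
  proof -
    have "((\<lambda>x. Lobachevsky (x + pi)) has_real_derivative - log_sin (y + pi) * 1) (at y)"
      by (rule DERIV_chain2[where f = Lobachevsky], rule DERIV_Lobachevsky)
        (use y in \<open>auto intro!: derivative_eq_intros\<close>)
    moreover have "(Lobachevsky has_real_derivative - log_sin y) (at y)"
      by (rule DERIV_Lobachevsky) (use y in auto)
    ultimately show ?thesis
      unfolding D_def by (auto intro!: derivative_eq_intros simp: log_sin_def)
  qed
  have const: "D y = D (-pi)" if "y \<in> {-pi..0}" for y
    by (rule DERIV_isconst2[OF _ cont]) (use der that in auto)
  have "D 0 = 0" by (simp add: D_def Lobachevsky_0 Lobachevsky_pi)
  thus ?thesis using const[OF assms] const[of 0] by (simp add: D_def)
qed

text \<open>
  The logarithmic singularity: adding \<open>s * ln \<bar>s\<bar>\<close> makes the function differentiable at \<open>0\<close>.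
\<close>

lemma DERIV_Lobachevsky_regularised_0:
  "((\<lambda>s. Lobachevsky s + s * ln \<bar>s\<bar>) has_real_derivative 1 - ln 2) (at 0)"
proof -
  define f where "f = (\<lambda>s. Lobachevsky s + s * ln \<bar>s\<bar>)"
  have "isCont Lobachevsky 0"
    using continuous_on_Lobachevsky by (rule continuous_on_interior) auto
  hence "(Lobachevsky \<longlongrightarrow> 0) (at 0)" by (simp add: isCont_def Lobachevsky_0)
  moreover have "((\<lambda>s::real. s * ln \<bar>s\<bar>) \<longlongrightarrow> 0) (at 0)" by real_asymp
  ultimately have f0: "(f \<longlongrightarrow> 0) (at 0)" unfolding f_def using tendsto_add by fastforce
  have "\<forall>\<^sub>F s in at 0. s \<noteq> 0 \<and> s \<in> {-pi<..<pi}"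
    by (intro eventually_conj eventually_at_in_open' eventually_neq_at_within) auto
  hence "((\<lambda>s. f s / s) \<longlongrightarrow> 1 - ln 2) (at 0)"
  proof (intro lhopital[where f = f and g = "\<lambda>s. s" and g' = "\<lambda>_. 1"
        and f' = "\<lambda>s. - log_sin s + (ln \<bar>s\<bar> + 1)"])
    assume ev: "\<forall>\<^sub>F s in at 0. s \<noteq> 0 \<and> s \<in> {-pi<..<pi}"
    show "\<forall>\<^sub>F s in at 0. (f has_real_derivative - log_sin s + (ln \<bar>s\<bar> + 1)) (at s)"
      using ev
    proof eventually_elim
      case (elim s)
      thus ?case unfolding f_def
        using DERIV_add[OF DERIV_Lobachevsky[of s] DERIV_mult[OF DERIV_ident DERIV_ln_abs[of s]]]
        by (simp add: add.commute)
    qed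
    show "((\<lambda>s. (- log_sin s + (ln \<bar>s\<bar> + 1)) / 1) \<longlongrightarrow> 1 - ln 2) (at 0)"
      unfolding log_sin_def by real_asymp
  qed (use f0 in \<open>auto intro!: eventually_neq_at_within tendsto_eq_intros\<close>)
  thus ?thesis
    unfolding has_field_derivative_iff f_def by (simp add: Lobachevsky_0)
qed

section \<open>The volume along a line of angles\<close>

lemma unit_eq_cis_Arg: "x = cis (Arg x)" if "cmod x = 1"
  using that rcis_cmod_Arg[of x] by (simp add: rcis_def)

lemma DERIV_Lobachevsky_Arg_regular:
  assumes "cmod x = 1" "x \<noteq> 1" "x \<noteq> -1"
  shows "((\<lambda>s. Lobachevsky (Arg (x * cis s))) has_real_derivative - ln \<bar>2 * Im x\<bar>) (at 0)"
proof -
  define \<theta> where "\<theta> = Arg x"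
  have x: "x = cis \<theta>" using unit_eq_cis_Arg[OF assms(1)] by (simp add: \<theta>_def)
  have "\<theta> \<noteq> 0" "\<theta> \<noteq> pi" using assms x by auto
  hence \<theta>: "\<theta> \<in> {-pi<..<pi}" "\<theta> \<noteq> 0" using Arg_bounded[of x] by (auto simp: \<theta>_def)
  have "((\<lambda>s. Lobachevsky (\<theta> + s)) has_real_derivative - log_sin (\<theta> + 0) * 1) (at 0)"
    by (rule DERIV_chain2[where f = Lobachevsky], rule DERIV_Lobachevsky)
      (use \<theta> in \<open>auto intro!: derivative_eq_intros\<close>)
  hence "((\<lambda>s. Lobachevsky (\<theta> + s)) has_real_derivative - ln \<bar>2 * Im x\<bar>) (at 0)"
    by (simp add: log_sin_def x)
  thus ?thesis
    by (rule has_field_derivative_transform_within_open[where S = "{-pi-\<theta><..<pi-\<theta>}"])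
      (use \<theta> in \<open>auto simp: x cis_mult Arg_cis\<close>)
qed

lemma DERIV_Lobachevsky_Arg_singular:
  assumes "x = 1 \<or> x = -1"
  shows "((\<lambda>s. Lobachevsky (Arg (x * cis s)) + s * ln \<bar>s\<bar>) has_real_derivative 1 - ln 2) (at 0)"
proof -
  have "Lobachevsky (Arg (x * cis s)) = Lobachevsky s" if s: "s \<in> {-pi<..<pi}" for s
  proof (cases "x = 1")
    case True
    thus ?thesis using s by (simp add: Arg_cis)
  next
    case False
    hence x: "x = -1" using assms by simp
    show ?thesis
    proof (cases "s \<le> 0")
      case True
      have "x * cis s = cis (s + pi)" by (simp add: x flip: cis_mult)
      thus ?thesis using s True by (simp add: Arg_cis Lobachevsky_plus_pi)
    next
      case False
      have "x * cis s = cis (s - pi)" by (simp add: x flip: cis_divide)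
      thus ?thesis using s False Lobachevsky_plus_pi[of "s - pi"] by (simp add: Arg_cis)
    qed
  qed
  thus ?thesis
    by (intro has_field_derivative_transform_within_open[OF DERIV_Lobachevsky_regularised_0,
          where S = "{-pi<..<pi}"]) auto
qed

text \<open>
  The derivative at \<open>s = 0\<close> of the volume of \<open>x * cis s\<close>, respectively of its regularisation by
  \<open>s * ln \<bar>s\<bar>\<close> if \<open>x\<close> is \<open>1\<close> or \<open>-1\<close>.
\<close>

definition slope :: "complex \<Rightarrow> real" where
  "slope x = (if x = 1 \<or> x = -1 then 1 - ln 2 else - ln \<bar>2 * Im x\<bar>)"

text \<open>
  The volume after turning each coordinate \<open>p q\<close> by the angle \<open>t * y q\<close>.
\<close>

definition circle_volume :: "'b set \<Rightarrow> ('b \<Rightarrow> complex) \<Rightarrow> ('b \<Rightarrow> real) \<Rightarrow> real \<Rightarrow> real" where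
  "circle_volume Q p y t = (\<Sum>q\<in>Q. Lobachevsky (Arg (p q * cis (t * y q))))"

lemma circle_volume_expansion:
  fixes p :: "'b \<Rightarrow> complex" and y :: "'b \<Rightarrow> real"
  assumes "finite Q" and "\<And>q. q \<in> Q \<Longrightarrow> cmod (p q) = 1"
  defines "U \<equiv> {q \<in> Q. p q = 1 \<or> p q = -1}"
  obtains D where
    "(D has_real_derivative (\<Sum>q\<in>Q. slope (p q) * y q)) (at 0)"
    "\<And>t. circle_volume Q p y t
         = D t - (\<Sum>q\<in>U. y q) * (t * ln \<bar>t\<bar>) - (\<Sum>q\<in>U. y q * ln \<bar>y q\<bar>) * t"
proof
  define D where "D = (\<lambda>t. \<Sum>q\<in>Q. Lobachevsky (Arg (p q * cis (t * y q))) +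
      (if q \<in> U then (t * y q) * ln \<bar>t * y q\<bar> else 0))"
  have "((\<lambda>t. Lobachevsky (Arg (p q * cis (t * y q))) +
      (if q \<in> U then (t * y q) * ln \<bar>t * y q\<bar> else 0)) has_real_derivative slope (p q) * y q) (at 0)"
    if q: "q \<in> Q" for q
  proof -
    have g: "((\<lambda>t. t * y q) has_real_derivative y q) (at 0)"
      by (auto intro!: derivative_eq_intros)
    show ?thesis
    proof (cases "q \<in> U")
      case True
      have "((\<lambda>s. Lobachevsky (Arg (p q * cis s)) + s * ln \<bar>s\<bar>)
          has_real_derivative slope (p q)) (at (0 * y q))"
        using True DERIV_Lobachevsky_Arg_singular[of "p q"] by (simp add: U_def slope_def)
      from DERIV_chain2[where f = "\<lambda>s. Lobachevsky (Arg (p q * cis s)) + s * ln \<bar>s\<bar>"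
          and g = "\<lambda>t. t * y q", OF this g] show ?thesis
        using True by simp
    next
      case False
      have "((\<lambda>s. Lobachevsky (Arg (p q * cis s)))
          has_real_derivative slope (p q)) (at (0 * y q))"
        using False q assms(2) DERIV_Lobachevsky_Arg_regular[of "p q"] by (simp add: U_def slope_def)
      from DERIV_chain2[where f = "\<lambda>s. Lobachevsky (Arg (p q * cis s))"
          and g = "\<lambda>t. t * y q", OF this g] show ?thesis
        using False by simp
    qed
  qed
  thus "(D has_real_derivative (\<Sum>q\<in>Q. slope (p q) * y q)) (at 0)"
    unfolding D_def by (intro DERIV_sum) auto
  fix t :: real
  have fin: "finite U" using assms(1) by (simp add: U_def)
  have "(\<Sum>q\<in>Q. if q \<in> U then (t * y q) * ln \<bar>t * y q\<bar> else 0)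
      = (\<Sum>q\<in>U. (t * y q) * ln \<bar>t * y q\<bar>)"
    using assms(1) by (intro sum.mono_neutral_cong_right) (auto simp: U_def)
  also have "\<dots> = (\<Sum>q\<in>U. y q * (t * ln \<bar>t\<bar>) + y q * ln \<bar>y q\<bar> * t)"
  proof (rule sum.cong[OF refl])
    fix q
    show "t * y q * ln \<bar>t * y q\<bar> = y q * (t * ln \<bar>t\<bar>) + y q * ln \<bar>y q\<bar> * t"
      by (cases "t = 0 \<or> y q = 0") (auto simp: abs_mult ln_mult algebra_simps)
  qed
  also have "\<dots> = (\<Sum>q\<in>U. y q) * (t * ln \<bar>t\<bar>) + (\<Sum>q\<in>U. y q * ln \<bar>y q\<bar>) * t"
    by (simp add: sum.distrib sum_distrib_right)
  finally show "circle_volume Q p y t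
       = D t - (\<Sum>q\<in>U. y q) * (t * ln \<bar>t\<bar>) - (\<Sum>q\<in>U. y q * ln \<bar>y q\<bar>) * t"
    unfolding circle_volume_def D_def sum.distrib by linarith
qed

text \<open>
  The function \<open>t * ln \<bar>t\<bar>\<close> has slope \<open>-\<infinity>\<close> at \<open>0\<close>: a positive multiple of it, subtracted from a
  differentiable function, destroys any maximum at \<open>0\<close>.
\<close>

lemma t_ln_t_not_locally_dominated:
  fixes D :: "real \<Rightarrow> real"
  assumes "(D has_real_derivative B) (at 0)"
    and "\<And>t. D t - s * (t * ln \<bar>t\<bar>) - h * t \<le> D 0"
  shows "s \<le> 0"
proof (rule ccontr)
  assume "\<not> s \<le> 0"
  hence s: "s > 0" by simp
  have "((\<lambda>t. (D t - D 0) / t) \<longlongrightarrow> B) (at 0)"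
    using assms(1) by (simp add: has_field_derivative_iff)
  hence "((\<lambda>t. (D t - D 0) / t) \<longlongrightarrow> B) (at_right 0)"
    by (rule filterlim_mono) (auto simp: at_within_le_at)
  hence "\<forall>\<^sub>F t in at_right 0. (D t - D 0) / t > B - 1"
    by (rule order_tendstoD) simp
  moreover have "\<forall>\<^sub>F t in at_right 0. ln t \<le> (B - 1 - h) / s"
    using ln_at_0 unfolding filterlim_at_bot by blast
  moreover have "\<forall>\<^sub>F t::real in at_right 0. t > 0" by (rule eventually_at_right_less)
  ultimately have "\<forall>\<^sub>F t::real in at_right 0. False"
  proof eventually_elim
    case (elim t)
    have "(D t - D 0 - s * (t * ln t) - h * t) / t \<le> 0"
      using assms(2)[of t] elim by (intro divide_nonpos_pos) auto
    hence "(D t - D 0) / t - s * ln t - h \<le> 0" using elim by (simp add: diff_divide_distrib)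
    moreover have "s * ln t \<le> B - 1 - h" using elim s by (simp add: field_simps)
    ultimately show ?case using elim by linarith
  qed
  thus False by simp
qed

text \<open>
  The condition for a maximum at \<open>t = 0\<close>.  It is invariant under \<open>y \<mapsto> -y\<close>, which reverses the line;
  this upgrades the inequality \<open>(\<Sum>q\<in>U. y q) \<le> 0\<close> to an equality and removes the term with
  \<open>t * ln \<bar>t\<bar>\<close>.
\<close>

lemma circle_volume_critical:
  fixes p :: "'b \<Rightarrow> complex" and y :: "'b \<Rightarrow> real"
  assumes "finite Q" and "\<And>q. q \<in> Q \<Longrightarrow> cmod (p q) = 1"
    and max: "\<And>t. circle_volume Q p y t \<le> circle_volume Q p y 0"
  defines "U \<equiv> {q \<in> Q. p q = 1 \<or> p q = -1}"
  shows "(\<Sum>q\<in>Q. slope (p q) * y q) = (\<Sum>q\<in>U. y q * ln \<bar>y q\<bar>)"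
proof -
  have nonpos: "(\<Sum>q\<in>U. w q) \<le> 0"
    if w: "\<And>t. circle_volume Q p w t \<le> circle_volume Q p w 0" for w
  proof -
    obtain D where D: "(D has_real_derivative (\<Sum>q\<in>Q. slope (p q) * w q)) (at 0)"
      and eq: "\<And>t. circle_volume Q p w t
           = D t - (\<Sum>q\<in>U. w q) * (t * ln \<bar>t\<bar>) - (\<Sum>q\<in>U. w q * ln \<bar>w q\<bar>) * t"
      using circle_volume_expansion[where p = p and y = w, OF assms(1,2)] unfolding U_def by blast
    show ?thesis
      by (rule t_ln_t_not_locally_dominated[OF D]) (use w in \<open>simp add: eq\<close>)
  qed
  have "circle_volume Q p (\<lambda>q. - y q) t = circle_volume Q p y (- t)" for t
    by (simp add: circle_volume_def)
  hence "(\<Sum>q\<in>U. - y q) \<le> 0" using max by (intro nonpos) simp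
  with nonpos[OF max] have s: "(\<Sum>q\<in>U. y q) = 0" by (simp add: sum_negf)
  obtain D where D: "(D has_real_derivative (\<Sum>q\<in>Q. slope (p q) * y q)) (at 0)"
    and eq: "\<And>t. circle_volume Q p y t
         = D t - (\<Sum>q\<in>U. y q) * (t * ln \<bar>t\<bar>) - (\<Sum>q\<in>U. y q * ln \<bar>y q\<bar>) * t"
    using circle_volume_expansion[where p = p and y = y, OF assms(1,2)] unfolding U_def by blast
  have "circle_volume Q p y = (\<lambda>t. D t - (\<Sum>q\<in>U. y q * ln \<bar>y q\<bar>) * t)"
    using eq s by auto
  hence "(circle_volume Q p y has_real_derivative
      (\<Sum>q\<in>Q. slope (p q) * y q) - (\<Sum>q\<in>U. y q * ln \<bar>y q\<bar>)) (at 0)"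
    using D by (auto intro!: derivative_eq_intros)
  from DERIV_local_max[OF this, of 1] max show ?thesis by auto
qed

section \<open>Linear algebra of coordinate functions\<close>

lemma vanishing_on_kernel_imp_combination:
  fixes a :: "'i \<Rightarrow> 'b \<Rightarrow> real" and w :: "'b \<Rightarrow> real"
  assumes "finite I" and Q: "finite Q"
    and "\<And>y. (\<forall>i\<in>I. (\<Sum>q\<in>Q. a i q * y q) = 0) \<Longrightarrow> (\<Sum>q\<in>Q. w q * y q) = 0"
  shows "\<exists>c. \<forall>q\<in>Q. w q = (\<Sum>i\<in>I. c i * a i q)"
  using assms(1,3)
proof (induction I arbitrary: w)
  case empty
  have "w q = 0" if q: "q \<in> Q" for q
  proof -
    have "(\<Sum>r\<in>Q. w r * (if r = q then 1 else 0)) = (\<Sum>r\<in>Q. if r = q then w r else 0)"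
      by (intro sum.cong) auto
    also have "\<dots> = w q" using q Q by simp
    finally have "w q = (\<Sum>r\<in>Q. w r * (if r = q then 1 else 0))" ..
    also have "\<dots> = 0" by (rule empty(1)) simp
    finally show ?thesis .
  qed
  thus ?case by simp
next
  case (insert i I)
  let ?pair = "\<lambda>u y. \<Sum>q\<in>Q. u q * (y q :: real)"
  show ?case
  proof (cases "\<exists>y. (\<forall>j\<in>I. ?pair (a j) y = 0) \<and> ?pair (a i) y \<noteq> 0")
    case True
    then obtain y0 where y0: "\<And>j. j \<in> I \<Longrightarrow> ?pair (a j) y0 = 0" "?pair (a i) y0 \<noteq> 0" by blast
    \<comment> \<open>Subtracting this multiple of \<open>a i\<close> makes \<open>w\<close> vanish at \<open>y0\<close>, so that the constraint \<open>a i\<close> can be dropped.\<close>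
    define r where "r = ?pair w y0 / ?pair (a i) y0"
    have "?pair (\<lambda>q. w q - r * a i q) y = 0" if y: "\<forall>j\<in>I. ?pair (a j) y = 0" for y
    proof -
      define s where "s = ?pair (a i) y / ?pair (a i) y0"
      have lin: "?pair u (\<lambda>q. y q - s * y0 q) = ?pair u y - s * ?pair u y0" for u
        by (simp add: sum_subtractf sum_distrib_left algebra_simps)
      have "?pair w (\<lambda>q. y q - s * y0 q) = 0"
      proof (rule insert.prems, rule ballI)
        fix j assume "j \<in> insert i I"
        thus "?pair (a j) (\<lambda>q. y q - s * y0 q) = 0"
          unfolding lin using y y0 by (auto simp: s_def)
      qed
      hence "?pair w y = s * ?pair w y0" by (simp add: lin)
      moreover have "?pair (\<lambda>q. w q - r * a i q) y = ?pair w y - r * ?pair (a i) y"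
        by (simp add: sum_subtractf sum_distrib_left algebra_simps)
      ultimately show ?thesis by (simp add: r_def s_def)
    qed
    from insert.IH[OF this] obtain c
      where c: "\<And>q. q \<in> Q \<Longrightarrow> w q - r * a i q = (\<Sum>j\<in>I. c j * a j q)" by blast
    have "w q = (\<Sum>j\<in>insert i I. (c(i := r)) j * a j q)" if "q \<in> Q" for q
    proof -
      have "(\<Sum>j\<in>I. (c(i := r)) j * a j q) = (\<Sum>j\<in>I. c j * a j q)"
        using insert.hyps by (intro sum.cong) auto
      thus ?thesis using c[OF that] insert.hyps by simp
    qed
    thus ?thesis by blast
  next
    case False
    hence "?pair w y = 0" if "\<forall>j\<in>I. ?pair (a j) y = 0" for y
      using insert.prems[of y] that by blast
    from insert.IH[OF this] obtain c
      where c: "\<And>q. q \<in> Q \<Longrightarrow> w q = (\<Sum>j\<in>I. c j * a j q)" by blast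
    have "w q = (\<Sum>j\<in>insert i I. (c(i := 0)) j * a j q)" if "q \<in> Q" for q
    proof -
      have "(\<Sum>j\<in>I. (c(i := 0)) j * a j q) = (\<Sum>j\<in>I. c j * a j q)"
        using insert.hyps by (intro sum.cong) auto
      thus ?thesis using c[OF that] insert.hyps by simp
    qed
    thus ?thesis by blast
  qed
qed

text \<open>
  A real vector space is not a finite union of proper subspaces, here kernels of coordinates.
\<close>

lemma exists_all_coordinates_nonzero:
  fixes V :: "('b \<Rightarrow> real) set"
  assumes "finite L" and zero: "(\<lambda>_. 0) \<in> V"
    and lin: "\<And>y z s. y \<in> V \<Longrightarrow> z \<in> V \<Longrightarrow> (\<lambda>q. y q + s * z q) \<in> V"
    and "\<And>q. q \<in> L \<Longrightarrow> \<exists>y\<in>V. y q \<noteq> 0"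
  shows "\<exists>y\<in>V. \<forall>q\<in>L. y q \<noteq> 0"
  using assms(1,4)
proof (induction L)
  case empty
  show ?case by (rule bexI[OF _ zero]) simp
next
  case (insert q L)
  have "\<exists>y\<in>V. \<forall>r\<in>L. y r \<noteq> 0" 
    by (rule insert.IH, rule insert.prems) (rule insertI2)
  then obtain y0 where y0: "y0 \<in> V" "\<And>r. r \<in> L \<Longrightarrow> y0 r \<noteq> 0" by auto
  obtain y1 where y1: "y1 \<in> V" "y1 q \<noteq> 0" 
    using insert.prems[OF insertI1] by auto
  have "finite (insert 0 ((\<lambda>r. - y0 r / y1 r) ` insert q L))" using insert.hyps by simp
  hence "\<exists>s. s \<notin> insert 0 ((\<lambda>r. - y0 r / y1 r) ` insert q L)"
    by (rule ex_new_if_finite[OF infinite_UNIV_char_0])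
  then obtain s where s: "s \<notin> insert 0 ((\<lambda>r. - y0 r / y1 r) ` insert q L)"
    by (rule exE)
  have "y0 r + s * y1 r \<noteq> 0" if r: "r \<in> insert q L" for r
  proof (cases "y1 r = 0")
    case True
    hence "r \<in> L" using r y1(2) by auto
    with True y0(2) show ?thesis by simp
  next
    case False
    have "- y0 r / y1 r \<in> (\<lambda>r. - y0 r / y1 r) ` insert q L" using r by (rule imageI)
    hence ne: "s \<noteq> - y0 r / y1 r" using s by (metis insertI2)
    show ?thesis
    proof
      assume "y0 r + s * y1 r = 0"
      hence "s * y1 r = - y0 r" by linarith
      hence "s = - y0 r / y1 r" using False by (metis nonzero_eq_divide_eq)
      with ne show False ..
    qed
  qed
  thus ?case by (intro bexI[OF _ lin[OF y0(1) y1(1), of s]] ballI)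
qed

text \<open>
  If no coordinate \<open>y r\<close> with \<open>r \<noteq> q\<close> were proportional to \<open>y q\<close>, there would be a point \<open>y0\<close> of \<open>V\<close>
  at which, among the coordinates in \<open>U\<close>, only the one of \<open>q\<close> vanishes.  Moving away from it in a
  direction with \<open>y q \<noteq> 0\<close>, all other summands are differentiable, and \<open>t * ln \<bar>t\<bar>\<close> would be so too.
\<close>

lemma entropy_linear_imp_dependent:
  fixes V :: "('b \<Rightarrow> real) set" and b :: "'b \<Rightarrow> real"
  assumes "finite U" and zero: "(\<lambda>_. 0) \<in> V"
    and lin: "\<And>y z s. y \<in> V \<Longrightarrow> z \<in> V \<Longrightarrow> (\<lambda>q. y q + s * z q) \<in> V"
    and eq: "\<And>y. y \<in> V \<Longrightarrow> (\<Sum>q\<in>Q. b q * y q) = (\<Sum>q\<in>U. y q * ln \<bar>y q\<bar>)"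
    and q: "q \<in> U"
    and nz: "\<And>r. r \<in> U \<Longrightarrow> \<exists>y\<in>V. y r \<noteq> 0"
  shows "\<exists>r\<in>U - {q}. \<exists>a. a \<noteq> 0 \<and> (\<forall>y\<in>V. y r = a * y q)"
proof (rule ccontr)
  assume indep: "\<not> ?thesis"
  obtain y1 where y1: "y1 \<in> V" "y1 q \<noteq> 0" using nz[OF q] by blast
  have "\<exists>y\<in>{y \<in> V. y q = 0}. \<forall>r\<in>U - {q}. y r \<noteq> 0"
  proof (rule exists_all_coordinates_nonzero)
    fix r assume r: "r \<in> U - {q}"
    show "\<exists>y\<in>{y \<in> V. y q = 0}. y r \<noteq> 0"
    proof (rule ccontr)
      assume none: "\<not> ?thesis"
      define a where "a = y1 r / y1 q"
      have *: "y r = a * y q" if y: "y \<in> V" for y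
      proof -
        define z where "z = (\<lambda>x. y x + (- y q / y1 q) * y1 x)"
        have "z \<in> V" unfolding z_def by (rule lin[OF y y1(1)])
        moreover have "z q = 0" using y1(2) by (simp add: z_def)
        ultimately have "z r = 0" using none by blast
        thus ?thesis by (simp add: z_def a_def)
      qed
      have "a \<noteq> 0"
      proof
        assume "a = 0"
        obtain y where "y \<in> V" "y r \<noteq> 0" using nz[of r] r by auto
        with *[of y] \<open>a = 0\<close> show False by simp
      qed
      hence "\<exists>a. a \<noteq> 0 \<and> (\<forall>y\<in>V. y r = a * y q)" using * by (intro exI[of _ a]) simp
      hence "\<exists>r\<in>U - {q}. \<exists>a. a \<noteq> 0 \<and> (\<forall>y\<in>V. y r = a * y q)" using r by (rule bexI)
      with indep show False by (rule notE)
    qed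
  qed (use assms(1) zero lin in auto)
  then obtain y0 where y0: "y0 \<in> V" "y0 q = 0" "\<And>r. r \<in> U - {q} \<Longrightarrow> y0 r \<noteq> 0" by blast
  define G where "G = (\<lambda>t. (\<Sum>x\<in>Q. b x * y0 x) + t * (\<Sum>x\<in>Q. b x * y1 x) - t * (y1 q * ln \<bar>y1 q\<bar>)
      - (\<Sum>r\<in>U - {q}. (y0 r + t * y1 r) * ln \<bar>y0 r + t * y1 r\<bar>))"
  have G: "G t = y1 q * (t * ln \<bar>t\<bar>)" for t
  proof -
    have "(\<Sum>x\<in>Q. b x * y0 x) + t * (\<Sum>x\<in>Q. b x * y1 x) = (\<Sum>x\<in>Q. b x * (y0 x + t * y1 x))"
      by (simp add: sum.distrib sum_distrib_left algebra_simps)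
    also have "\<dots> = (\<Sum>r\<in>U. (y0 r + t * y1 r) * ln \<bar>y0 r + t * y1 r\<bar>)"
      by (rule eq[OF lin[OF y0(1) y1(1)]])
    also have "\<dots> = (t * y1 q) * ln \<bar>t * y1 q\<bar>
        + (\<Sum>r\<in>U - {q}. (y0 r + t * y1 r) * ln \<bar>y0 r + t * y1 r\<bar>)"
      using y0(2) by (simp add: sum.remove[OF assms(1) q])
    also have "(t * y1 q) * ln \<bar>t * y1 q\<bar> = y1 q * (t * ln \<bar>t\<bar>) + t * (y1 q * ln \<bar>y1 q\<bar>)"
      using y1(2) by (cases "t = 0") (auto simp: abs_mult ln_mult algebra_simps)
    finally show ?thesis by (simp add: G_def)
  qed
  have "((\<lambda>t. (y0 r + t * y1 r) * ln \<bar>y0 r + t * y1 r\<bar>) has_real_derivative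
      (ln \<bar>y0 r\<bar> + 1) * y1 r) (at 0)" if r: "r \<in> U - {q}" for r
  proof -
    have outer: "((\<lambda>x. x * ln \<bar>x\<bar>) has_real_derivative ln \<bar>y0 r\<bar> + 1) (at (y0 r + 0 * y1 r))"
      using DERIV_mult[OF DERIV_ident DERIV_ln_abs[OF y0(3)[OF r]]] y0(3)[OF r] by simp
    have inner: "((\<lambda>t. y0 r + t * y1 r) has_real_derivative y1 r) (at 0)"
      by (auto intro!: derivative_eq_intros)
    show ?thesis
      by (rule DERIV_chain2[where f = "\<lambda>x. x * ln \<bar>x\<bar>" and g = "\<lambda>t. y0 r + t * y1 r", OF outer inner])
  qed
  hence "((\<lambda>t. \<Sum>r\<in>U - {q}. (y0 r + t * y1 r) * ln \<bar>y0 r + t * y1 r\<bar>) has_real_derivative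
      (\<Sum>r\<in>U - {q}. (ln \<bar>y0 r\<bar> + 1) * y1 r)) (at 0)"
    by (intro DERIV_sum) auto
  moreover have "((\<lambda>t. (\<Sum>x\<in>Q. b x * y0 x) + t * (\<Sum>x\<in>Q. b x * y1 x) - t * (y1 q * ln \<bar>y1 q\<bar>))
      has_real_derivative (\<Sum>x\<in>Q. b x * y1 x) - y1 q * ln \<bar>y1 q\<bar>) (at 0)"
    by (rule derivative_eq_intros refl)+ simp
  ultimately obtain B where "(G has_real_derivative B) (at 0)"
    unfolding G_def using DERIV_diff by blast
  hence "((\<lambda>t. G t / y1 q) has_real_derivative B / y1 q) (at 0)" by (rule DERIV_cdivide)
  hence "(1::real) \<le> 0"
    by (rule t_ln_t_not_locally_dominated[where h = 0]) (use y1(2) in \<open>simp add: G\<close>)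
  thus False by simp
qed

section \<open>Edges and quadrilaterals of a triangulation\<close>

text \<open>
  The edge of the triangulation that contains a given edge of a tetrahedron.
\<close>

definition edge_class :: "'a gluing \<Rightarrow> 'a tet_edge \<Rightarrow> 'a tet_edge set" where
  "edge_class M d = (edge_glue M \<union> (edge_glue M)\<inverse>)\<^sup>* `` {d}"

lemma edge_class_eq_iff:
  "edge_class M d = edge_class M d' \<longleftrightarrow> (d, d') \<in> (edge_glue M \<union> (edge_glue M)\<inverse>)\<^sup>*"
proof -
  have "equiv UNIV ((edge_glue M \<union> (edge_glue M)\<inverse>)\<^sup>*)"
    by (intro equivI sym_rtrancl trans_rtrancl refl_rtrancl) (auto simp: sym_def)
  thus ?thesis unfolding edge_class_def by (subst eq_equiv_class_iff) auto
qed

lemma edges_eq: "edges M = edge_class M ` tet_edges M"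
  by (auto simp: edges_def edge_class_def quotient_def)

lemma mem_edge_iff:
  assumes "e \<in> edges M"
  shows "d \<in> e \<longleftrightarrow> edge_class M d = e"
proof -
  obtain d' where e: "e = edge_class M d'" using assms unfolding edges_eq by (rule imageE)
  have "d \<in> e \<longleftrightarrow> edge_class M d' = edge_class M d"
    unfolding edge_class_eq_iff by (simp add: e edge_class_def)
  thus ?thesis unfolding e by auto
qed

lemma edge_class_glue:
  assumes "\<sigma> \<in> tets M" "k \<in> vlabels" "s \<subseteq> vlabels" "card s = 2" "k \<notin> s"
  shows "edge_class M (nbr M \<sigma> k, perm M \<sigma> k ` s) = edge_class M (\<sigma>, s)"
proof -
  have "((\<sigma>, s), (nbr M \<sigma> k, perm M \<sigma> k ` s)) \<in> edge_glue M"
    using assms by (auto simp: edge_glue_def tet_edges_def)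
  hence "((\<sigma>, s), (nbr M \<sigma> k, perm M \<sigma> k ` s)) \<in> (edge_glue M \<union> (edge_glue M)\<inverse>)\<^sup>*" by blast
  thus ?thesis using edge_class_eq_iff by blast
qed

lemma finite_edges: "finite (tets M) \<Longrightarrow> finite (edges M)"
proof -
  assume "finite (tets M)"
  moreover have "tet_edges M \<subseteq> tets M \<times> Pow vlabels" by (auto simp: tet_edges_def)
  ultimately have "finite (tet_edges M)" by (auto intro: finite_subset)
  thus ?thesis by (simp add: edges_eq)
qed

lemma pair_of_labels_cases:
  assumes "s \<subseteq> vlabels" "card s = 2"
  shows "s \<in> {{0, 1}, {0, 2}, {0, 3}, {2, 3}, {1, 3}, {1, 2}}"
proof -
  obtain a b where "s = {a, b}" "a \<noteq> b" using assms(2) by (auto simp: card_2_iff)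
  moreover from this have "a \<in> vlabels" "b \<in> vlabels" using assms(1) by auto
  ultimately show ?thesis unfolding insert_iff by (elim disjE) (simp_all add: doubleton_eq_iff)
qed

lemma label_complements:
  "vlabels - {0, 1} = {2, 3}" "vlabels - {0, 2} = {1, 3}" "vlabels - {0, 3} = {1, 2}"
  "vlabels - {2, 3} = {0, 1}" "vlabels - {1, 3} = {0, 2}" "vlabels - {1, 2} = {0, 3}"
  by auto

lemma card_label_complement:
  assumes "s \<subseteq> vlabels" "card s = 2"
  shows "card (vlabels - s) = 2"
proof -
  have "finite s" using assms(1) by (rule finite_subset) simp
  hence "card (vlabels - s) = card vlabels - card s" using assms(1) by (rule card_Diff_subset)
  moreover have "card vlabels = 4" by simp
  ultimately have "card (vlabels - s) = 4 - 2" by (simp only: assms(2))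
  also have "4 - 2 = (2 :: nat)" by simp
  finally show ?thesis .
qed

lemma quads_in_eq:
  "quads_in \<sigma> = {(\<sigma>, opp_pair {0, 1}), (\<sigma>, opp_pair {0, 2}), (\<sigma>, opp_pair {0, 3})}"
  (is "_ = ?Q")
proof
  show "quads_in \<sigma> \<subseteq> ?Q"
  proof
    fix q assume "q \<in> quads_in \<sigma>"
    then obtain s where q: "q = (\<sigma>, opp_pair s)" "s \<subseteq> vlabels" "card s = 2" by (auto simp: quads_in_def)
    have "opp_pair {2, 3} = opp_pair {0, 1}" "opp_pair {1, 3} = opp_pair {0, 2}"
      "opp_pair {1, 2} = opp_pair {0, 3}"
      unfolding opp_pair_def label_complements by (rule insert_commute)+
    thus "q \<in> ?Q" using pair_of_labels_cases[OF q(2,3)] q(1) by auto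
  qed
  have "(\<sigma>, opp_pair s) \<in> quads_in \<sigma>" if "s \<subseteq> vlabels" "card s = 2" for s
    using that by (auto simp: quads_in_def)
  thus "?Q \<subseteq> quads_in \<sigma>" by auto
qed

lemma opp_pair_distinct:
  "opp_pair {0, 1} \<noteq> opp_pair {0, 2}" "opp_pair {0, 1} \<noteq> opp_pair {0, 3}"
  "opp_pair {0, 2} \<noteq> opp_pair {0, 3}"
  unfolding opp_pair_def label_complements by (simp_all add: doubleton_eq_iff)

lemma sum_quads_in:
  "(\<Sum>q\<in>quads_in \<sigma>. f q) = f (\<sigma>, opp_pair {0, 1}) + f (\<sigma>, opp_pair {0, 2}) + f (\<sigma>, opp_pair {0, 3})"
  for f :: "_ \<Rightarrow> 'c :: comm_monoid_add"
  unfolding quads_in_eq using opp_pair_distinct by (simp add: add.assoc)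

lemma prod_quads_in:
  "(\<Prod>q\<in>quads_in \<sigma>. f q) = f (\<sigma>, opp_pair {0, 1}) * f (\<sigma>, opp_pair {0, 2}) * f (\<sigma>, opp_pair {0, 3})"
  for f :: "_ \<Rightarrow> 'c :: comm_monoid_mult"
  unfolding quads_in_eq using opp_pair_distinct by (simp add: mult.assoc)

lemma finite_quads: "finite (tets M) \<Longrightarrow> finite (quads M)"
  by (auto simp: quads_def quads_in_eq)

lemma sum_quads:
  assumes "finite (tets M)"
  shows "(\<Sum>q\<in>quads M. f q) = (\<Sum>\<sigma>\<in>tets M. \<Sum>q\<in>quads_in \<sigma>. f q)"
  unfolding quads_def using assms
  by (intro sum.UNION_disjoint) (auto simp: quads_in_eq)

text \<open>
  A quadrilateral is disjoint from exactly two edges of its tetrahedron, each of which contributes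
  to one index.
\<close>

lemma quad_index_eq:
  assumes "e \<in> edges M" "s \<subseteq> vlabels" "card s = 2"
  shows "quad_index (\<sigma>, opp_pair s) e
       = of_bool (edge_class M (\<sigma>, s) = e) + of_bool (edge_class M (\<sigma>, vlabels - s) = e)"
proof -
  have ne: "s \<noteq> vlabels - s" 
  proof
    assume "s = vlabels - s"
    hence "s = {}" by blast
    with assms(3) show False by simp
  qed
  have "{d \<in> e. fst d = \<sigma> \<and> snd d \<in> opp_pair s}
      = {d \<in> {(\<sigma>, s), (\<sigma>, vlabels - s)}. edge_class M d = e}"
    by (intro Collect_cong) (auto simp: mem_edge_iff[OF assms(1)] opp_pair_def prod_eq_iff)
  also have "\<dots> = (if edge_class M (\<sigma>, s) = e then {(\<sigma>, s)} else {})
       \<union> (if edge_class M (\<sigma>, vlabels - s) = e then {(\<sigma>, vlabels - s)} else {})" by auto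
  also have "card \<dots> = of_bool (edge_class M (\<sigma>, s) = e) + of_bool (edge_class M (\<sigma>, vlabels - s) = e)"
    using ne by (subst card_Un_disjoint) auto
  finally show ?thesis by (simp add: quad_index_def)
qed

lemma sum_quad_index:
  fixes d :: "'a tet_edge set \<Rightarrow> real"
  assumes "finite (tets M)" "\<sigma> \<in> tets M" "s \<subseteq> vlabels" "card s = 2"
  shows "(\<Sum>e\<in>edges M. d e * real (quad_index (\<sigma>, opp_pair s) e))
       = d (edge_class M (\<sigma>, s)) + d (edge_class M (\<sigma>, vlabels - s))"
proof -
  have fin: "finite (edges M)" using assms(1) by (rule finite_edges)
  have "(\<sigma>, vlabels - s) \<in> tet_edges M"
    using assms(2) card_label_complement[OF assms(3,4)]
    by (simp only: tet_edges_def mem_Collect_eq case_prod_conv Diff_subset simp_thms)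
  hence mem2: "edge_class M (\<sigma>, vlabels - s) \<in> edges M" unfolding edges_eq by (rule imageI)
  have "(\<sigma>, s) \<in> tet_edges M"
    using assms(2-4) by (simp only: tet_edges_def mem_Collect_eq case_prod_conv simp_thms)
  hence mem1: "edge_class M (\<sigma>, s) \<in> edges M" unfolding edges_eq by (rule imageI)
  have delta: "(\<Sum>e\<in>edges M. d e * of_bool (x = e)) = d x" if "x \<in> edges M" for x
  proof -
    have "(\<Sum>e\<in>edges M. d e * of_bool (x = e)) = (\<Sum>e\<in>edges M. if x = e then d e else 0)"
      by (rule sum.cong) auto
    also have "\<dots> = d x" unfolding sum.delta'[OF fin] using that by (rule if_P)
    finally show ?thesis .
  qed
  have "(\<Sum>e\<in>edges M. d e * real (quad_index (\<sigma>, opp_pair s) e))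
      = (\<Sum>e\<in>edges M. d e * of_bool (edge_class M (\<sigma>, s) = e)
                     + d e * of_bool (edge_class M (\<sigma>, vlabels - s) = e))"
    by (rule sum.cong[OF refl]) (simp only: quad_index_eq[OF _ assms(3,4)] of_nat_add of_nat_of_bool distrib_left)
  also have "\<dots> = d (edge_class M (\<sigma>, s)) + d (edge_class M (\<sigma>, vlabels - s))"
    unfolding sum.distrib delta[OF mem1] delta[OF mem2] ..
  finally show ?thesis .
qed

section \<open>Edge weights and the normal surface equation\<close>

text \<open>
  A weight on the edges of the tetrahedra that is compatible with the face pairings, hence a weight
  on the edges of the triangulation.
\<close>

definition glue_invariant :: "'a gluing \<Rightarrow> ('a tet_edge \<Rightarrow> real) \<Rightarrow> bool" where
  "glue_invariant M D \<longleftrightarrow> (\<forall>\<sigma>\<in>tets M. \<forall>k\<in>vlabels. \<forall>s. s \<subseteq> vlabels \<longrightarrow> card s = 2 \<longrightarrow> k \<notin> s \<longrightarrow>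
     D (nbr M \<sigma> k, perm M \<sigma> k ` s) = D (\<sigma>, s))"

lemma glue_invariant_edge_class: "glue_invariant M (\<lambda>d. f (edge_class M d))"
  unfolding glue_invariant_def by (auto simp: edge_class_glue)

text \<open>
  The vector \<open>w\<close> on the quadrilaterals is a combination of the tetrahedron equations, with
  coefficients \<open>c\<close>, and of the edge equations, with coefficients \<open>D\<close>.
\<close>

definition quad_potential ::
  "'a gluing \<Rightarrow> ('a \<Rightarrow> real) \<Rightarrow> ('a tet_edge \<Rightarrow> real) \<Rightarrow> ('a nquad \<Rightarrow> real) \<Rightarrow> bool" where
  "quad_potential M c D w \<longleftrightarrow> glue_invariant M D \<and>
     (\<forall>\<sigma>\<in>tets M. \<forall>s. s \<subseteq> vlabels \<longrightarrow> card s = 2 \<longrightarrow>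
        w (\<sigma>, opp_pair s) = c \<sigma> + D (\<sigma>, s) + D (\<sigma>, vlabels - s))"

lemma quad_potentialI:
  assumes "glue_invariant M D"
    and "\<And>\<sigma> s. \<sigma> \<in> tets M \<Longrightarrow> s \<subseteq> vlabels \<Longrightarrow> card s = 2 \<Longrightarrow>
       w (\<sigma>, opp_pair s) = c \<sigma> + D (\<sigma>, s) + D (\<sigma>, vlabels - s)"
  shows "quad_potential M c D w"
  using assms unfolding quad_potential_def by blast

lemma quad_potentialD:
  assumes "quad_potential M c D w"
  shows "glue_invariant M D"
    and "\<sigma> \<in> tets M \<Longrightarrow> s \<subseteq> vlabels \<Longrightarrow> card s = 2 \<Longrightarrow>
       w (\<sigma>, opp_pair s) = c \<sigma> + D (\<sigma>, s) + D (\<sigma>, vlabels - s)"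
  using assms unfolding quad_potential_def by blast+

text \<open>
  With this choice of triangle coordinates, the sum of the triangle and quadrilateral coordinates at
  an arc of face \<open>k\<close> cutting off \<open>v\<close> involves only the weights of the three edges of that face:
  the constant of the tetrahedron and the weight of the edge \<open>vk\<close> cancel.  Hence it is the same on
  both sides of the face.
\<close>

lemma haken_solution_from_edges:
  assumes M: "oriented_triangulation M" and pot: "quad_potential M c D xq"
  shows "haken_solution M (\<lambda>(\<sigma>, v). - c \<sigma> - (\<Sum>u\<in>vlabels - {v}. D (\<sigma>, {v, u}))) xq"
proof -
  note D = quad_potentialD(1)[OF pot] and xq = quad_potentialD(2)[OF pot]
  \<comment> \<open>An opaque name keeps the simplifier from enumerating the four labels.\<close>
  define L where "L = vlabels"
  define T where "T = (\<lambda>(\<sigma>, v). - c \<sigma> - (\<Sum>u\<in>L - {v}. D (\<sigma>, {v, u})))"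
  have finL: "finite L" by (simp add: L_def)
  have side: "T (\<sigma>, v) + xq (\<sigma>, opp_pair {v, k})
      = D (\<sigma>, L - {v, k}) - (\<Sum>u\<in>L - {v, k}. D (\<sigma>, {v, u}))"
    if "\<sigma> \<in> tets M" "k \<in> L" "v \<in> L" "v \<noteq> k" for \<sigma> k v
  proof -
    have "xq (\<sigma>, opp_pair {v, k}) = c \<sigma> + D (\<sigma>, {v, k}) + D (\<sigma>, L - {v, k})"
      unfolding L_def by (rule xq) (use that in \<open>simp_all add: L_def\<close>)
    moreover have "(\<Sum>u\<in>L - {v}. D (\<sigma>, {v, u}))
        = D (\<sigma>, {v, k}) + (\<Sum>u\<in>L - {v} - {k}. D (\<sigma>, {v, u}))"
      using that finL by (intro sum.remove) auto
    moreover have "L - {v} - {k} = L - {v, k}" by auto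
    ultimately show ?thesis by (simp add: T_def)
  qed
  have "T (\<sigma>, v) + xq (\<sigma>, opp_pair {v, k})
      = T (nbr M \<sigma> k, perm M \<sigma> k v) + xq (nbr M \<sigma> k, opp_pair {perm M \<sigma> k v, perm M \<sigma> k k})"
    if A: "\<sigma> \<in> tets M" "k \<in> L" "v \<in> L" "v \<noteq> k" for \<sigma> k v
  proof -
    define \<tau> where "\<tau> = perm M \<sigma> k"
    have \<tau>: "\<tau> permutes L" and nb: "nbr M \<sigma> k \<in> tets M"
      using M A unfolding oriented_triangulation_def \<tau>_def L_def[symmetric] by blast+
    have inj: "inj \<tau>" using \<tau> by (rule permutes_inj)
    have image: "L - {\<tau> v, \<tau> k} = \<tau> ` (L - {v, k})"
      using permutes_image[OF \<tau>] by (simp add: image_set_diff[OF inj])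
    have Dinv: "D (nbr M \<sigma> k, \<tau> ` s) = D (\<sigma>, s)" if "s \<subseteq> L" "card s = 2" "k \<notin> s" for s
      using D A that unfolding glue_invariant_def \<tau>_def L_def[symmetric] by blast
    have "card {v, k} = 2" using A by simp
    hence "card (L - {v, k}) = 2"
      using card_label_complement[of "{v, k}"] A unfolding L_def[symmetric] by simp
    hence "D (nbr M \<sigma> k, L - {\<tau> v, \<tau> k}) = D (\<sigma>, L - {v, k})"
      unfolding image by (intro Dinv) auto
    moreover have "(\<Sum>u\<in>L - {\<tau> v, \<tau> k}. D (nbr M \<sigma> k, {\<tau> v, u}))
        = (\<Sum>u\<in>L - {v, k}. D (nbr M \<sigma> k, \<tau> ` {v, u}))"
      unfolding image by (subst sum.reindex[OF inj_on_subset[OF inj]]) auto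
    moreover have "\<dots> = (\<Sum>u\<in>L - {v, k}. D (\<sigma>, {v, u}))"
      by (intro sum.cong refl Dinv) (use A in \<open>auto simp: card_insert_if\<close>)
    moreover have "\<tau> v \<in> L" "\<tau> k \<in> L" "\<tau> v \<noteq> \<tau> k"
      using permutes_in_image[OF \<tau>] A inj by (auto dest: injD)
    ultimately show ?thesis
      using side[OF A] side[OF nb, of "\<tau> k" "\<tau> v"] by (simp add: \<tau>_def)
  qed
  thus ?thesis unfolding haken_solution_def T_def[symmetric] L_def[symmetric] Let_def by blast
qed

section \<open>The antisymmetric pairing of edges\<close>

text \<open>
  A permutation \<open>\<pi>\<close> stands for a flag of the tetrahedron: its face opposite to \<open>\<pi> 3\<close>, with a corner
  \<open>\<pi> 1\<close> between the edges \<open>\<pi> 0 \<pi> 1\<close> and \<open>\<pi> 1 \<pi> 2\<close> of that face.  Crossing the face is an involution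
  on the flags.  It composes \<open>\<pi>\<close> with an odd permutation and preserves the two edge weights, so that
  it changes the sign of every term.
\<close>

lemma sum_flags_eq_0:
  assumes M: "oriented_triangulation M" and D: "glue_invariant M D" and E: "glue_invariant M E"
  shows "(\<Sum>\<sigma>\<in>tets M. \<Sum>\<pi> | \<pi> permutes vlabels.
      of_int (sign \<pi>) * (E (\<sigma>, {\<pi> 0, \<pi> 1}) * D (\<sigma>, {\<pi> 1, \<pi> 2}))) = 0"
proof -
  define F where "F = (\<lambda>(\<sigma>, \<pi> :: nat \<Rightarrow> nat).
      of_int (sign \<pi>) * (E (\<sigma>, {\<pi> 0, \<pi> 1}) * D (\<sigma>, {\<pi> 1, \<pi> 2})))"
  define \<Phi> where "\<Phi> = (\<lambda>(\<sigma>, \<pi> :: nat \<Rightarrow> nat). (nbr M \<sigma> (\<pi> 3), perm M \<sigma> (\<pi> 3) \<circ> \<pi>))"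
  define S where "S = tets M \<times> {\<pi>. \<pi> permutes vlabels}"
  have step: "\<Phi> (\<sigma>, \<pi>) \<in> S \<and> \<Phi> (\<Phi> (\<sigma>, \<pi>)) = (\<sigma>, \<pi>) \<and> F (\<Phi> (\<sigma>, \<pi>)) = - F (\<sigma>, \<pi>)"
    if \<sigma>: "\<sigma> \<in> tets M" and \<pi>: "\<pi> permutes vlabels" for \<sigma> \<pi>
  proof -
    define k where "k = \<pi> 3"
    define \<tau> where "\<tau> = perm M \<sigma> k"
    have k: "k \<in> vlabels" using permutes_in_image[OF \<pi>, of 3] by (simp add: k_def)
    have \<tau>: "\<tau> permutes vlabels" "sign \<tau> = -1" "nbr M \<sigma> k \<in> tets M"
      "nbr M (nbr M \<sigma> k) (\<tau> k) = \<sigma>" "perm M (nbr M \<sigma> k) (\<tau> k) = inv \<tau>"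
      using M \<sigma> k unfolding oriented_triangulation_def \<tau>_def by blast+
    have "\<Phi> (\<sigma>, \<pi>) \<in> S"
      using \<tau> \<pi> by (auto simp: \<Phi>_def S_def k_def \<tau>_def intro: permutes_compose)
    moreover have "\<Phi> (\<Phi> (\<sigma>, \<pi>)) = (\<sigma>, \<pi>)"
      using \<tau> permutes_inv_o(2)[OF \<tau>(1)] by (simp add: \<Phi>_def o_assoc flip: k_def \<tau>_def)
    moreover have "F (\<Phi> (\<sigma>, \<pi>)) = - F (\<sigma>, \<pi>)"
    proof -
      have "permutation \<tau>" "permutation \<pi>"
        using \<tau>(1) \<pi> by (auto intro!: permutation_permutes[THEN iffD2] exI[of _ vlabels])
      hence sgn: "sign (\<tau> \<circ> \<pi>) = - sign \<pi>" using \<tau>(2) by (simp add: sign_compose)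
      have inj: "\<pi> i = \<pi> j \<longleftrightarrow> i = j" for i j using permutes_inj[OF \<pi>] by (auto dest: injD)
      have in_v: "\<pi> i \<in> vlabels" if "i \<in> vlabels" for i using permutes_in_image[OF \<pi>] that by simp
      have *: "G (nbr M \<sigma> k, {\<tau> (\<pi> i), \<tau> (\<pi> j)}) = G (\<sigma>, {\<pi> i, \<pi> j})"
        if "glue_invariant M G" "i \<in> {0, 1, 2}" "j \<in> {0, 1, 2}" "i \<noteq> j" for G i j
      proof -
        have "G (nbr M \<sigma> k, \<tau> ` {\<pi> i, \<pi> j}) = G (\<sigma>, {\<pi> i, \<pi> j})"
          using that(1) \<sigma> k unfolding glue_invariant_def \<tau>_def
          by (elim ballE[where x = \<sigma>] ballE[where x = k] allE[where x = "{\<pi> i, \<pi> j}"])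
            (use that(2-4) in_v[of i] in_v[of j] in \<open>auto simp: card_insert_if inj k_def\<close>)
        thus ?thesis by simp
      qed
      show ?thesis
        using *[OF E, of 0 1] *[OF D, of 1 2] by (simp add: F_def \<Phi>_def sgn flip: k_def \<tau>_def)
    qed
    ultimately show ?thesis by blast
  qed
  have "sum F S = sum (\<lambda>x. - F x) S"
    by (rule sum.reindex_bij_witness[where i = \<Phi> and j = \<Phi>]) (use step in \<open>auto simp: S_def\<close>)
  hence "sum F S = 0" by (simp add: sum_negf)
  thus ?thesis by (simp add: sum.cartesian_product F_def S_def case_prod_unfold)
qed

text \<open>
  Edges that are equal or opposite do not contribute, and any two adjacent edges contribute once in
  each order.  Grouped by quadrilaterals, the flags of a tetrahedron therefore give the pairing defined
  by the cyclic order of its three quadrilaterals.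
\<close>

lemma sum_permutations_of_labels:
  fixes D E :: "nat set \<Rightarrow> real"
  shows "(\<Sum>\<pi> | \<pi> permutes vlabels. of_int (sign \<pi>) * (E {\<pi> 0, \<pi> 1} * D {\<pi> 1, \<pi> 2}))
    = - ((E {0, 1} + E {2, 3}) * ((D {0, 2} + D {1, 3}) - (D {0, 3} + D {1, 2}))
       + (E {0, 2} + E {1, 3}) * ((D {0, 3} + D {1, 2}) - (D {0, 1} + D {2, 3}))
       + (E {0, 3} + E {1, 2}) * ((D {0, 1} + D {2, 3}) - (D {0, 2} + D {1, 3})))"
proof -
  have sgn: "sign (Transposition.transpose a b \<circ> q) = (if a = b then 1 else -1) * sign q"
    if "permutation q" for a b :: nat and q
    using that by (simp add: sign_compose permutation_swap_id sign_swap_id)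
  have c: "{1, 0} = {0, 1::nat}" "{2, 0} = {0, 2::nat}" "{3, 0} = {0, 3::nat}"
      "{3, 2} = {2, 3::nat}" "{3, 1} = {1, 3::nat}" "{2, 1} = {1, 2::nat}"
      "{Suc 0, 0} = {0, 1::nat}" "{3, Suc 0} = {1, 3::nat}" "{2, Suc 0} = {1, 2::nat}" by auto
  show ?thesis
    by (simp add: sum_over_permutations_insert sgn sign_swap_id permutation_compose
        permutation_swap_id Transposition.transpose_def c del: One_nat_def)
      (simp add: algebra_simps c del: One_nat_def)
qed

section \<open>Tangent vectors of the space of angle structures\<close>

text \<open>
  The solutions of the tetrahedron and edge equations for infinitesimal changes of the angles.
\<close>

definition tangent_SAS :: "'a gluing \<Rightarrow> ('a nquad \<Rightarrow> real) set" where
  "tangent_SAS M = {y. (\<forall>\<sigma>\<in>tets M. (\<Sum>q\<in>quads_in \<sigma>. y q) = 0) \<and>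
     (\<forall>e\<in>edges M. (\<Sum>q\<in>quads M. real (quad_index q e) * y q) = 0)}"

lemma zero_in_tangent_SAS: "(\<lambda>_. 0) \<in> tangent_SAS M"
  by (simp add: tangent_SAS_def)

lemma tangent_SAS_combination:
  assumes "y \<in> tangent_SAS M" "z \<in> tangent_SAS M"
  shows "(\<lambda>q. y q + s * z q) \<in> tangent_SAS M"
proof -
  have "(\<Sum>q\<in>quads M. real (quad_index q e) * (y q + s * z q))
      = (\<Sum>q\<in>quads M. real (quad_index q e) * y q) + s * (\<Sum>q\<in>quads M. real (quad_index q e) * z q)"
    for e by (simp add: sum.distrib sum_distrib_left algebra_simps)
  thus ?thesis using assms by (simp add: tangent_SAS_def sum.distrib flip: sum_distrib_left)
qed

lemma prod_cis: "(\<Prod>q\<in>A. cis (f q)) = cis (\<Sum>q\<in>A. f q)"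
  by (induction A rule: infinite_finite_induct) (simp_all add: cis_mult)

lemma SAS_flow:
  assumes "p \<in> SAS M" "y \<in> tangent_SAS M"
  shows "(\<lambda>q\<in>quads M. p q * cis (t * y q)) \<in> SAS M"
proof -
  let ?x = "\<lambda>q\<in>quads M. p q * cis (t * y q)"
  have "?x \<in> quads M \<rightarrow>\<^sub>E sphere 0 1"
    using assms(1) by (auto simp: SAS_def norm_mult)
  moreover have "(\<Prod>q\<in>quads_in \<sigma>. ?x q) = -1" if "\<sigma> \<in> tets M" for \<sigma>
  proof -
    have "(\<Prod>q\<in>quads_in \<sigma>. ?x q) = (\<Prod>q\<in>quads_in \<sigma>. p q * cis (t * y q))"
      using that by (intro prod.cong) (auto simp: quads_def)
    also have "\<dots> = (\<Prod>q\<in>quads_in \<sigma>. p q) * cis (t * (\<Sum>q\<in>quads_in \<sigma>. y q))"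
      by (simp add: prod.distrib prod_cis sum_distrib_left)
    finally show ?thesis using assms that by (simp add: SAS_def tangent_SAS_def)
  qed
  moreover have "(\<Prod>q\<in>quads M. ?x q ^ quad_index q e) = 1" if "e \<in> edges M" for e
  proof -
    have "(\<Prod>q\<in>quads M. ?x q ^ quad_index q e)
        = (\<Prod>q\<in>quads M. p q ^ quad_index q e * cis (t * (real (quad_index q e) * y q)))"
      by (intro prod.cong) (auto simp: power_mult_distrib Complex.DeMoivre mult.left_commute)
    also have "\<dots> = (\<Prod>q\<in>quads M. p q ^ quad_index q e)
        * cis (t * (\<Sum>q\<in>quads M. real (quad_index q e) * y q))"
      by (simp add: prod.distrib prod_cis sum_distrib_left)
    finally show ?thesis using assms that by (simp add: SAS_def tangent_SAS_def)
  qed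
  ultimately show ?thesis by (simp add: SAS_def)
qed

lemma volume_maximum_critical:
  assumes "finite (tets M)" and p: "p \<in> SAS M"
    and max: "\<forall>x\<in>SAS M. SAS_volume M x \<le> SAS_volume M p"
    and y: "y \<in> tangent_SAS M"
  shows "(\<Sum>q\<in>quads M. slope (p q) * y q)
       = (\<Sum>q | q \<in> quads M \<and> (p q = 1 \<or> p q = -1). y q * ln \<bar>y q\<bar>)"
proof (rule circle_volume_critical)
  show "finite (quads M)" using assms(1) by (rule finite_quads)
  show "cmod (p q) = 1" if "q \<in> quads M" for q
    using p that by (auto simp: SAS_def dist_norm)
  fix t
  have "SAS_volume M (\<lambda>q\<in>quads M. p q * cis (t * y q)) = circle_volume (quads M) p y t"
    by (simp add: SAS_volume_def circle_volume_def)
  moreover have "SAS_volume M p = circle_volume (quads M) p y 0"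
    by (simp add: SAS_volume_def circle_volume_def)
  ultimately show "circle_volume (quads M) p y t \<le> circle_volume (quads M) p y 0"
    using max SAS_flow[OF p y, of t] by metis
qed

text \<open>
  The two families of equations are indexed by the disjoint sum of \<open>tets M\<close> and \<open>edges M\<close>.
\<close>

lemma tangent_SAS_annihilator:
  fixes w :: "'a nquad \<Rightarrow> real"
  assumes fin: "finite (tets M)"
    and w: "\<And>y. y \<in> tangent_SAS M \<Longrightarrow> (\<Sum>q\<in>quads M. w q * y q) = 0"
  obtains c D where "quad_potential M c D w"
proof -
  define a :: "'a + 'a tet_edge set \<Rightarrow> 'a nquad \<Rightarrow> real" where
    "a = case_sum (\<lambda>\<sigma> q. of_bool (fst q = \<sigma>)) (\<lambda>e q. real (quad_index q e))"
  have finI: "finite (tets M <+> edges M)" using fin finite_edges[OF fin] by simp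
  have finQ: "finite (quads M)" using fin by (rule finite_quads)
  have "(\<Sum>q\<in>quads M. w q * y q) = 0"
    if y: "\<forall>i\<in>tets M <+> edges M. (\<Sum>q\<in>quads M. a i q * y q) = 0" for y
  proof (rule w)
    have "(\<Sum>q\<in>quads_in \<sigma>. y q) = 0" if \<sigma>: "\<sigma> \<in> tets M" for \<sigma>
    proof -
      have "(\<Sum>q\<in>quads M. a (Inl \<sigma>) q * y q) = (\<Sum>q\<in>quads_in \<sigma>. y q)"
        using finQ \<sigma> by (intro sum.mono_neutral_cong_right) (auto simp: a_def quads_def quads_in_def)
      thus ?thesis using y \<sigma> by (auto dest: bspec[where x = "Inl \<sigma>"])
    qed
    moreover have "(\<Sum>q\<in>quads M. real (quad_index q e) * y q) = 0" if "e \<in> edges M" for e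
      using y that by (auto simp: a_def dest: bspec[where x = "Inr e"])
    ultimately show "y \<in> tangent_SAS M" by (simp add: tangent_SAS_def)
  qed
  from vanishing_on_kernel_imp_combination[OF finI finQ this]
  obtain b where b: "\<And>q. q \<in> quads M \<Longrightarrow> w q = (\<Sum>i\<in>tets M <+> edges M. b i * a i q)" by blast
  have "quad_potential M (b \<circ> Inl) (\<lambda>x. (b \<circ> Inr) (edge_class M x)) w"
  proof (rule quad_potentialI[OF glue_invariant_edge_class])
    fix \<sigma> s assume \<sigma>: "\<sigma> \<in> tets M" and s: "s \<subseteq> vlabels" "card s = 2"
    have "(\<sigma>, opp_pair s) \<in> quads M" using \<sigma> s unfolding quads_def quads_in_def by blast
    hence "w (\<sigma>, opp_pair s) = (\<Sum>\<tau>\<in>tets M. b (Inl \<tau>) * of_bool (\<sigma> = \<tau>))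
        + (\<Sum>e\<in>edges M. (b \<circ> Inr) e * real (quad_index (\<sigma>, opp_pair s) e))"
      by (simp only: b sum.Plus[OF fin finite_edges[OF fin]]) (simp add: a_def)
    also have "(\<Sum>\<tau>\<in>tets M. b (Inl \<tau>) * of_bool (\<sigma> = \<tau>)) = (\<Sum>\<tau>\<in>tets M. if \<sigma> = \<tau> then b (Inl \<tau>) else 0)"
      by (rule sum.cong) auto
    also have "\<dots> = b (Inl \<sigma>)" unfolding sum.delta'[OF fin] using \<sigma> by (rule if_P)
    finally show "w (\<sigma>, opp_pair s) = (b \<circ> Inl) \<sigma> + (b \<circ> Inr) (edge_class M (\<sigma>, s))
        + (b \<circ> Inr) (edge_class M (\<sigma>, vlabels - s))"
      unfolding sum_quad_index[OF fin \<sigma> s] by simp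
  qed
  thus ?thesis by (rule that)
qed

section \<open>Maxima at non-smooth points\<close>

lemma nonsmooth_maximum_haken:
  fixes M :: "'a gluing" and p :: "'a nquad \<Rightarrow> complex"
  assumes M: "oriented_triangulation M" and p: "p \<in> SAS M"
    and max: "\<forall>x\<in>SAS M. SAS_volume M x \<le> SAS_volume M p"
    and "\<not> smooth_point M p"
  shows "\<exists>xt xq. haken_solution M xt xq \<and> card {q \<in> quads M. xq q \<noteq> 0} \<in> {1, 2}"
proof -
  have fin: "finite (tets M)" using M by (simp add: oriented_triangulation_def)
  have finQ: "finite (quads M)" using fin by (rule finite_quads)
  have haken: ?thesis
    if ann: "\<And>y. y \<in> tangent_SAS M \<Longrightarrow> (\<Sum>q\<in>quads M. w q * y q) = 0"
      and card: "card {q \<in> quads M. w q \<noteq> 0} \<in> {1, 2}" for w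
  proof -
    obtain c D where "quad_potential M c D w" by (rule tangent_SAS_annihilator[OF fin ann])
    from haken_solution_from_edges[OF M this] card show ?thesis by blast
  qed
  define U where "U = {q \<in> quads M. p q = 1 \<or> p q = -1}"
  have finU: "finite U" using finQ by (simp add: U_def)
  obtain q where q: "q \<in> U" using assms(4) by (auto simp: smooth_point_def U_def)
  have delta: "(\<Sum>x\<in>quads M. of_bool (x = r) * y x) = y r" if "r \<in> U" for r and y :: "'a nquad \<Rightarrow> real"
  proof -
    have "(\<Sum>x\<in>quads M. of_bool (x = r) * y x) = (\<Sum>x\<in>quads M. if x = r then y x else 0)"
      by (rule sum.cong) auto
    also have "\<dots> = y r" using that finQ by (simp add: U_def)
    finally show ?thesis .
  qed
  show ?thesis
  proof (cases "\<exists>r\<in>U. \<forall>y\<in>tangent_SAS M. y r = 0")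
    case True
    then obtain r where r: "r \<in> U" "\<And>y. y \<in> tangent_SAS M \<Longrightarrow> y r = 0" by blast
    have "{x \<in> quads M. (of_bool (x = r) :: real) \<noteq> 0} = {r}" using r(1) by (auto simp: U_def)
    thus ?thesis by (intro haken[of "\<lambda>x. of_bool (x = r)"]) (simp_all add: delta[OF r(1)] r(2))
  next
    case False
    have "\<exists>r\<in>U - {q}. \<exists>a. a \<noteq> 0 \<and> (\<forall>y\<in>tangent_SAS M. y r = a * y q)"
    proof (rule entropy_linear_imp_dependent[OF finU zero_in_tangent_SAS tangent_SAS_combination])
      show "(\<Sum>x\<in>quads M. slope (p x) * y x) = (\<Sum>x\<in>U. y x * ln \<bar>y x\<bar>)"
        if "y \<in> tangent_SAS M" for y
        unfolding U_def using fin p max that by (rule volume_maximum_critical)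
    qed (use q False in auto)
    then obtain r a where r: "r \<in> U" "r \<noteq> q" and a: "a \<noteq> 0"
      and dep: "\<And>y. y \<in> tangent_SAS M \<Longrightarrow> y r = a * y q" by blast
    let ?w = "\<lambda>x. of_bool (x = r) - a * of_bool (x = q)"
    have "{x \<in> quads M. ?w x \<noteq> 0} = {r, q}" using r q a by (auto simp: U_def)
    hence card: "card {x \<in> quads M. ?w x \<noteq> 0} = 2" using r(2) by simp
    have "(\<Sum>x\<in>quads M. ?w x * y x)
        = (\<Sum>x\<in>quads M. of_bool (x = r) * y x) - a * (\<Sum>x\<in>quads M. of_bool (x = q) * y x)" for y
      by (simp only: left_diff_distrib sum_subtractf sum_distrib_left mult.assoc)
    hence "(\<Sum>x\<in>quads M. ?w x * y x) = 0" if "y \<in> tangent_SAS M" for y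
      using dep[OF that] by (simp only: delta[OF r(1)] delta[OF q] diff_self)
    thus ?thesis using card by (intro haken[of ?w]) simp_all
  qed
qed

section \<open>Maxima at smooth points\<close>

text \<open>
  The successor of a quadrilateral in the cyclic order of its tetrahedron.
\<close>

definition next_quad :: "'a nquad \<Rightarrow> 'a nquad" where
  "next_quad q = (fst q,
     if snd q = opp_pair {0, 1} then opp_pair {0, 2}
     else if snd q = opp_pair {0, 2} then opp_pair {0, 3} else opp_pair {0, 1})"

lemma next_quad_simps:
  "next_quad (\<sigma>, opp_pair {0, 1}) = (\<sigma>, opp_pair {0, 2})"
  "next_quad (\<sigma>, opp_pair {0, 2}) = (\<sigma>, opp_pair {0, 3})"
  "next_quad (\<sigma>, opp_pair {0, 3}) = (\<sigma>, opp_pair {0, 1})"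
  by (simp_all only: next_quad_def fst_conv snd_conv opp_pair_distinct
      opp_pair_distinct[symmetric] if_True if_False refl simp_thms)

lemma quads_cases:
  assumes "q \<in> quads M"
  obtains \<sigma> where "\<sigma> \<in> tets M"
    "q = (\<sigma>, opp_pair {0, 1}) \<or> q = (\<sigma>, opp_pair {0, 2}) \<or> q = (\<sigma>, opp_pair {0, 3})"
  using assms unfolding quads_def quads_in_eq by blast

lemma quad_next_imp_eq: "quad_next q q' \<Longrightarrow> q' = next_quad q"
  unfolding quad_next_def
  by (cases q; cases q') (auto simp only: fst_conv snd_conv prod.inject insert_iff empty_iff next_quad_simps)

lemma next_quad_in_quads: "q \<in> quads M \<Longrightarrow> next_quad q \<in> quads M"
  by (erule quads_cases) (auto simp: quads_def quads_in_eq next_quad_simps simp del: One_nat_def)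

lemma next_quad_cycle:
  assumes "q \<in> quads M"
  shows "next_quad (next_quad (next_quad q)) = q"
  using assms by (rule quads_cases) (auto simp: next_quad_simps simp del: One_nat_def)

lemma SAS_prod_cycle:
  assumes "p \<in> SAS M" "q \<in> quads M"
  shows "p q * p (next_quad q) * p (next_quad (next_quad q)) = -1"
proof -
  obtain \<sigma> where \<sigma>: "\<sigma> \<in> tets M"
    "q = (\<sigma>, opp_pair {0, 1}) \<or> q = (\<sigma>, opp_pair {0, 2}) \<or> q = (\<sigma>, opp_pair {0, 3})"
    using assms(2) by (rule quads_cases)
  have "p (\<sigma>, opp_pair {0, 1}) * p (\<sigma>, opp_pair {0, 2}) * p (\<sigma>, opp_pair {0, 3}) = -1"
    using assms(1) \<sigma>(1) unfolding SAS_def prod_quads_in by blast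
  thus ?thesis using \<sigma>(2) by (elim disjE) (simp_all only: next_quad_simps mult_ac)
qed

text \<open>
  The condition on the product says that \<open>x, x', x''\<close> are the angles of a triangle, modulo the signs
  that occur for angles outside \<open>(0, pi)\<close>; \<open>z\<close> is the quotient of its two sides, as complex numbers,
  that enclose the angle \<open>x\<close>.  The identity \<open>key\<close> is the closing condition of the triangle.
\<close>

lemma unit_triple_shape:
  fixes x x' x'' :: complex
  assumes "cmod x = 1" "cmod x' = 1" "x * x' * x'' = -1"
    and Im: "Im x \<noteq> 0" "Im x' \<noteq> 0" "Im x'' \<noteq> 0"
  defines "z \<equiv> x * of_real (Im x' / Im x'')"
  shows "z \<noteq> 0" "z \<noteq> 1" "x' * of_real (Im x'' / Im x) = 1 / (1 - z)"
proof -
  have n: "(Re x)\<^sup>2 + (Im x)\<^sup>2 = 1" "(Re x')\<^sup>2 + (Im x')\<^sup>2 = 1"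
    using assms(1,2) by (simp_all add: cmod_def)
  have "cmod (x * x') = 1" using assms by (simp add: norm_mult)
  hence "x * x' * cnj (x * x') = 1" by (simp only: complex_norm_square[symmetric]) simp
  hence "x'' = - cnj (x * x')"
    using assms(3) by (metis mult.commute mult.left_commute mult_minus_left mult_1 minus_mult_minus)
  hence im: "Im x'' = Re x * Im x' + Im x * Re x'" by simp
  have "Im x * Re x' * Re x' + Im x * Im x' * Im x' = Im x * ((Re x')\<^sup>2 + (Im x')\<^sup>2)"
    by (simp add: algebra_simps power2_eq_square)
  hence "Im x * Re x' * Re x' + Im x * Im x' * Im x' = Im x" unfolding n(2) by simp
  hence key: "x' * (of_real (Im x'') - x * of_real (Im x')) = of_real (Im x)"
    unfolding im by (simp add: complex_eq_iff algebra_simps)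
  show "z \<noteq> 0" using Im by (auto simp: z_def)
  have z: "1 - z = (of_real (Im x'') - x * of_real (Im x')) / of_real (Im x'')"
    using Im by (simp add: z_def field_simps)
  define W where "W = of_real (Im x'') - x * of_real (Im x')"
  have W: "x' * W = of_real (Im x)" using key by (simp add: W_def)
  hence "W \<noteq> 0" using Im by auto
  have z: "1 - z = W / of_real (Im x'')" using z by (simp add: W_def)
  thus "z \<noteq> 1" using \<open>W \<noteq> 0\<close> Im by auto
  have "x' * of_real (Im x'' / Im x) * W = of_real (Im x'' / Im x) * (x' * W)"
    by (simp only: mult_ac)
  also have "\<dots> = of_real (Im x'')" unfolding W of_real_mult[symmetric] using Im by simp
  finally have "x' * of_real (Im x'' / Im x) = of_real (Im x'') / W"
    using \<open>W \<noteq> 0\<close> nonzero_eq_divide_eq by blast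
  thus "x' * of_real (Im x'' / Im x) = 1 / (1 - z)"
    unfolding z by simp
qed

text \<open>
  The constants \<open>c\<close> of the tetrahedra drop out of the differences, and what remains is the pairing of
  the edge \<open>e\<close> with the edge weight \<open>D\<close>.
\<close>

lemma edge_pairing_eq_0:
  assumes M: "oriented_triangulation M" and e: "e \<in> edges M" and pot: "quad_potential M c D L"
  shows "(\<Sum>q\<in>quads M. real (quad_index q e) * (L (next_quad (next_quad q)) - L (next_quad q))) = 0"
proof -
  note D = quad_potentialD(1)[OF pot] and L = quad_potentialD(2)[OF pot]
  have fin: "finite (tets M)" using M by (simp add: oriented_triangulation_def)
  define E :: "'a tet_edge \<Rightarrow> real" where "E = (\<lambda>d. of_bool (edge_class M d = e))"
  have E: "glue_invariant M E" unfolding E_def by (rule glue_invariant_edge_class)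
  have idx: "real (quad_index (\<sigma>, opp_pair s) e) = E (\<sigma>, s) + E (\<sigma>, vlabels - s)"
    if "s \<subseteq> vlabels" "card s = 2" for \<sigma> s
    by (simp only: quad_index_eq[OF e that] E_def of_nat_add of_nat_of_bool)
  have labels: "{0, 1} \<subseteq> vlabels" "{0, 2} \<subseteq> vlabels" "{0, 3} \<subseteq> vlabels"
    "card {0, 1::nat} = 2" "card {0, 2::nat} = 2" "card {0, 3::nat} = 2" by auto
  have "(\<Sum>q\<in>quads_in \<sigma>. real (quad_index q e) * (L (next_quad (next_quad q)) - L (next_quad q)))
      = (\<Sum>\<pi> | \<pi> permutes vlabels.
          of_int (sign \<pi>) * (E (\<sigma>, {\<pi> 0, \<pi> 1}) * D (\<sigma>, {\<pi> 1, \<pi> 2})))" if \<sigma>: "\<sigma> \<in> tets M" for \<sigma>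
    unfolding sum_quads_in next_quad_simps L[OF \<sigma> labels(1,4)] L[OF \<sigma> labels(2,5)]
      L[OF \<sigma> labels(3,6)] idx[OF labels(1,4)] idx[OF labels(2,5)] idx[OF labels(3,6)]
      label_complements sum_permutations_of_labels[of "\<lambda>s. E (\<sigma>, s)" "\<lambda>s. D (\<sigma>, s)"]
    by (simp add: algebra_simps del: One_nat_def)
  hence "(\<Sum>q\<in>quads M. real (quad_index q e) * (L (next_quad (next_quad q)) - L (next_quad q)))
      = (\<Sum>\<sigma>\<in>tets M. \<Sum>\<pi> | \<pi> permutes vlabels.
          of_int (sign \<pi>) * (E (\<sigma>, {\<pi> 0, \<pi> 1}) * D (\<sigma>, {\<pi> 1, \<pi> 2})))"
    unfolding sum_quads[OF fin] by (rule sum.cong[OF refl])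
  thus ?thesis using sum_flags_eq_0[OF M D E] by (rule trans)
qed

lemma smooth_maximum_thurston:
  fixes M :: "'a gluing" and p :: "'a nquad \<Rightarrow> complex"
  assumes M: "oriented_triangulation M" and p: "p \<in> SAS M"
    and max: "\<forall>x\<in>SAS M. SAS_volume M x \<le> SAS_volume M p"
    and smooth: "smooth_point M p"
  shows "\<exists>z. thurston_solution M z"
proof -
  have fin: "finite (tets M)" using M by (simp add: oriented_triangulation_def)
  have finQ: "finite (quads M)" using fin by (rule finite_quads)
  have unit: "cmod (p q) = 1" if "q \<in> quads M" for q
    using p that by (auto simp: SAS_def dist_norm)
  have Im: "Im (p q) \<noteq> 0" if q: "q \<in> quads M" for q
  proof
    assume "Im (p q) = 0"
    moreover from this have "\<bar>Re (p q)\<bar> = 1" using unit[OF q] by (simp add: cmod_def)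
    ultimately have "p q = 1 \<or> p q = -1" by (auto simp: complex_eq_iff abs_if split: if_splits)
    thus False using smooth q by (auto simp: smooth_point_def)
  qed
  define L where "L = (\<lambda>q. slope (p q))"
  have L: "L q = - ln \<bar>2 * Im (p q)\<bar>" if "q \<in> quads M" for q
    using smooth that by (auto simp: L_def slope_def smooth_point_def)
  have U: "{q \<in> quads M. p q = 1 \<or> p q = -1} = {}" using smooth by (auto simp: smooth_point_def)
  have ann: "(\<Sum>q\<in>quads M. L q * y q) = 0" if "y \<in> tangent_SAS M" for y
    using volume_maximum_critical[OF fin p max that] unfolding U L_def by simp
  obtain c D where pot: "quad_potential M c D L" by (rule tangent_SAS_annihilator[OF fin ann])
  define r where "r = (\<lambda>q. Im (p (next_quad q)) / Im (p (next_quad (next_quad q))))"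
  define z where "z = (\<lambda>q. p q * of_real (r q))"
  have shape: "z q \<noteq> 0 \<and> z q \<noteq> 1 \<and> z (next_quad q) = 1 / (1 - z q)" if q: "q \<in> quads M" for q
  proof -
    note q' = next_quad_in_quads[OF q]
    note q'' = next_quad_in_quads[OF q']
    from unit_triple_shape[OF unit[OF q] unit[OF q'] SAS_prod_cycle[OF p q] Im[OF q] Im[OF q'] Im[OF q'']]
    show ?thesis by (simp add: z_def r_def next_quad_cycle[OF q])
  qed
  have "(\<Prod>q\<in>quads M. z q ^ quad_index q e) \<in> {1, -1}" if e: "e \<in> edges M" for e
  proof -
    have r: "r q \<noteq> 0 \<and> ln \<bar>r q\<bar> = L (next_quad (next_quad q)) - L (next_quad q)"
      if q: "q \<in> quads M" for q
    proof -
      note q' = next_quad_in_quads[OF q]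
      note q'' = next_quad_in_quads[OF q']
      show ?thesis
        using Im[OF q'] Im[OF q''] by (simp add: r_def L[OF q'] L[OF q''] abs_mult ln_mult ln_div)
    qed
    \<comment> \<open>The product differs from that of \<open>p\<close> by the real factor \<open>R\<close>, whose modulus is 1 by the vanishing of the pairing.\<close>
    define R where "R = (\<Prod>q\<in>quads M. r q ^ quad_index q e)"
    have "\<bar>R\<bar> = (\<Prod>q\<in>quads M. exp (real (quad_index q e) * ln \<bar>r q\<bar>))"
      unfolding R_def abs_prod
    proof (rule prod.cong[OF refl])
      fix q assume "q \<in> quads M"
      hence "r q \<noteq> 0" using r by blast
      hence "exp (ln \<bar>r q\<bar>) = \<bar>r q\<bar>" by simp
      thus "\<bar>r q ^ quad_index q e\<bar> = exp (real (quad_index q e) * ln \<bar>r q\<bar>)"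
        by (simp only: power_abs exp_of_nat_mult)
    qed
    also have "\<dots> = exp (\<Sum>q\<in>quads M. real (quad_index q e) * ln \<bar>r q\<bar>)"
      using finQ by (simp add: exp_sum)
    also have "(\<Sum>q\<in>quads M. real (quad_index q e) * ln \<bar>r q\<bar>)
        = (\<Sum>q\<in>quads M. real (quad_index q e) * (L (next_quad (next_quad q)) - L (next_quad q)))"
      using r by (intro sum.cong) auto
    also have "\<dots> = 0" by (rule edge_pairing_eq_0[OF M e pot])
    finally have "R = 1 \<or> R = -1" by (simp add: abs_if split: if_splits)
    moreover have "(\<Prod>q\<in>quads M. z q ^ quad_index q e)
        = (\<Prod>q\<in>quads M. p q ^ quad_index q e) * of_real R"
      by (simp add: z_def R_def power_mult_distrib prod.distrib)
    moreover have "(\<Prod>q\<in>quads M. p q ^ quad_index q e) = 1" using p e by (simp add: SAS_def)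
    ultimately show ?thesis by auto
  qed
  hence "thurston_solution M z"
    unfolding thurston_solution_def using shape by (auto dest!: quad_next_imp_eq)
  thus ?thesis by blast
qed

theorem theorem1p1:
  fixes M :: "'a gluing" and p :: "'a nquad \<Rightarrow> complex"
  assumes "oriented_triangulation M"
    and "p \<in> SAS M"
    and "\<forall>x\<in>SAS M. SAS_volume M x \<le> SAS_volume M p"
  shows "(smooth_point M p \<longrightarrow> (\<exists>z. thurston_solution M z)) \<and>
         (\<not> smooth_point M p \<longrightarrow>
            (\<exists>xt xq. haken_solution M xt xq \<and> card {q \<in> quads M. xq q \<noteq> 0} \<in> {1, 2}))"
  using smooth_maximum_thurston[OF assms] nonsmooth_maximum_haken[OF assms] by blast

end
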